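(* Let $X$ be a Hausdorff, locally compact, second countable topological space and let $\mathcal{H}$ be a Hilbert space. Let $F:\mathcal{B}(X)\to\mathcal{L}_s^+(\mathcal{H})$ be a POVM, $A$ a bounded self-adjoint operator on $\mathcal{H}$ with spectral measure $E^A$, and $\mu:\sigma(A)\times\mathcal{B}(X)\to[0,1]$ a weak Markov kernel with respect to $E^A$, such that $(F,A,\mu)$ is a von Neumann triplet, and suppose that $A$ is a sharp version of $F$. Then there exists a (Borel) set $\Gamma\subseteq\sigma(A)$ with $E^A(\Gamma)=\mathbf{1}$ such that the family of functions $\{\mu_{\Delta}(\cdot)\}_{\Delta\in\mathcal{B}(X)}$ separates the points of $\Gamma$; that is, for all $\lambda,\lambda'\in\Gamma$ with $\lambda\neq\lambda'$ there is $\Delta\in\mathcal{B}(X)$ with $\mu_\Delta(\lambda)\neq\mu_\Delta(\lambda')$.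
   Context: $\mathcal{B}(X)$ is the Borel $\sigma$-algebra of $X$; $\mathcal{L}_s^+(\mathcal{H})$ is the set of bounded positive self-adjoint operators on $\mathcal{H}$; $\mathbf{1}$ is the identity operator. A POVM is a map $F:\mathcal{B}(X)\to\mathcal{L}_s^+(\mathcal{H})$ with $F(\bigcup_{n}\Delta_n)=\sum_{n}F(\Delta_n)$ for every countable family of pairwise disjoint Borel sets, the series converging in the weak operator topology. For a bounded self-adjoint operator $A$, $\sigma(A)\subset\mathbb{R}$ is its spectrum and $E^A$ its projection valued spectral measure on $\mathcal{B}(\sigma(A))$, $A=\int\lambda\,dE^A_\lambda$. For a bounded Borel function $g$ on $\sigma(A)$, $g(A)=\int g(\lambda)\,dE^A_\lambda$. A map $\mu:\Lambda\times\mathcal{B}(X)\to[0,1]$, $(\lambda,\Delta)\mapsto\mu_\Delta(\lambda)$ (with $\Lambda\subset\mathbb{R}$) is a weak Markov kernel with respect to a measure $\nu$ on $\Lambda$ if: (1) $\mu_\Delta(\cdot)$ is Borel measurable for each $\Delta\in\mathcal{B}(X)$; (2) for every $\Delta$, $0\le\mu_\Delta(\lambda)\le1$ for $\nu$-a.e. $\lambda$; (3) $\mu_X(\lambda)=1$ and $\mu_\emptyset(\lambda)=0$ for $\nu$-a.e. $\lambda$; (4) for any sequence $\{\Delta_i\}$ of pairwise disjoint Borel sets, $\sum_i\mu_{\Delta_i}(\lambda)=\mu_{\cup_i\Delta_i}(\lambda)$ for $\nu$-a.e. $\lambda$. It is a weak Markov kernel with respect to a projection valued measure $E$ on $\mathcal{B}(\Lambda)$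 if it is one with respect to each measure $\langle E(\cdot)\psi,\psi\rangle$, $\psi\in\mathcal{H}$. $(F,A,\mu)$ is a von Neumann triplet if $F(\Delta)=\mu_\Delta(A)$ for all $\Delta\in\mathcal{B}(X)$. For a von Neumann triplet $(F,A,\mu)$ with $A$ bounded, $A$ is a sharp version of $F$ if the von Neumann algebra generated by $A$ equals the von Neumann algebra generated by $\{F(\Delta)\}_{\Delta\in\mathcal{B}(X)}$.
   Formalization: The Hilbert space H is additionally assumed separable; for non-separable H the claim fails, e.g. for A = x ⊕ (x+2) on ℓ²([0,1]) ⊕ L²([0,1]) with μ_Δ(x) = μ_Δ(x+2) = 1_Δ(x). *)

theory Defs
  imports "HOL-Analysis.Analysis"
begin

section \<open>Complex Hilbert spaces and bounded operators\<close>

text \<open>The real inner product inherited from \<^class>\<open>real_inner\<close> is the real part of the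
  complex one, so norm, metric and topology are the usual ones. The complex inner product is
  linear in its first argument.\<close>

class complex_hilbert = real_inner + complete_space +
  fixes scaleC :: "complex \<Rightarrow> 'a \<Rightarrow> 'a"  (infixr "*\<^sub>C" 75)
    and cinner :: "'a \<Rightarrow> 'a \<Rightarrow> complex"
  assumes scaleC_add_right: "c *\<^sub>C (x + y) = c *\<^sub>C x + c *\<^sub>C y"
    and scaleC_add_left: "(c + d) *\<^sub>C x = c *\<^sub>C x + d *\<^sub>C x"
    and scaleC_scaleC: "c *\<^sub>C (d *\<^sub>C x) = (c * d) *\<^sub>C x"
    and scaleC_of_real: "complex_of_real r *\<^sub>C x = r *\<^sub>R x"
    and cinner_add_left: "cinner (x + y) z = cinner x z + cinner y z"
    and cinner_scaleC_left: "cinner (c *\<^sub>C x) y = c * cinner x y"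
    and cinner_commute: "cinner x y = cnj (cinner y x)"
    and Re_cinner: "Re (cinner x y) = inner x y"

definition bounded_clinear :: "('h::complex_hilbert \<Rightarrow> 'h) \<Rightarrow> bool" where
  "bounded_clinear T \<longleftrightarrow> bounded_linear T \<and> (\<forall>c x. T (c *\<^sub>C x) = c *\<^sub>C T x)"

definition is_adjoint :: "('h::complex_hilbert \<Rightarrow> 'h) \<Rightarrow> ('h \<Rightarrow> 'h) \<Rightarrow> bool" where
  "is_adjoint S T \<longleftrightarrow> bounded_clinear S \<and> bounded_clinear T
     \<and> (\<forall>x y. cinner (T x) y = cinner x (S y))"

definition bounded_selfadjoint :: "('h::complex_hilbert \<Rightarrow> 'h) \<Rightarrow> bool" where
  "bounded_selfadjoint T \<longleftrightarrow> is_adjoint T T"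

definition bounded_positive :: "('h::complex_hilbert \<Rightarrow> 'h) \<Rightarrow> bool" where
  "bounded_positive T \<longleftrightarrow> bounded_selfadjoint T \<and> (\<forall>x. 0 \<le> Re (cinner (T x) x))"

definition orthogonal_projection :: "('h::complex_hilbert \<Rightarrow> 'h) \<Rightarrow> bool" where
  "orthogonal_projection P \<longleftrightarrow> bounded_selfadjoint P \<and> P \<circ> P = P"

definition op_spectrum :: "('h::complex_hilbert \<Rightarrow> 'h) \<Rightarrow> complex set" where
  "op_spectrum A = {z. \<not> (\<exists>R. bounded_clinear R
     \<and> R \<circ> (\<lambda>x. A x - z *\<^sub>C x) = id \<and> (\<lambda>x. A x - z *\<^sub>C x) \<circ> R = id)}"

text \<open>The spectrum of a self-adjoint operator is contained in the real line; this is that spectrum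
  as a set of reals.\<close>

definition real_spectrum :: "('h::complex_hilbert \<Rightarrow> 'h) \<Rightarrow> real set" where
  "real_spectrum A = {t. complex_of_real t \<in> op_spectrum A}"

section \<open>Weak operator topology and von Neumann algebras\<close>

text \<open>The initial topology on the bounded operators for all maps
  \<open>T \<mapsto> \<langle>T x, y\<rangle>\<close>; the topology on the functions of \<open>(x, y)\<close> is the product topology.\<close>

definition weak_operator_topology :: "('h::complex_hilbert \<Rightarrow> 'h) topology" where
  "weak_operator_topology =
     pullback_topology (Collect bounded_clinear) (\<lambda>T (x, y). cinner (T x) y) euclidean"

definition von_neumann_algebra :: "('h::complex_hilbert \<Rightarrow> 'h) set \<Rightarrow> bool" where
  "von_neumann_algebra M \<longleftrightarrow>
     M \<subseteq> Collect bounded_clinear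
   \<and> id \<in> M
   \<and> (\<forall>S\<in>M. \<forall>T\<in>M. (\<lambda>x. S x + T x) \<in> M)
   \<and> (\<forall>c. \<forall>T\<in>M. (\<lambda>x. c *\<^sub>C T x) \<in> M)
   \<and> (\<forall>S\<in>M. \<forall>T\<in>M. S \<circ> T \<in> M)
   \<and> (\<forall>T\<in>M. \<forall>S. is_adjoint S T \<longrightarrow> S \<in> M)
   \<and> closedin weak_operator_topology M"

definition generated_von_neumann_algebra ::
    "('h::complex_hilbert \<Rightarrow> 'h) set \<Rightarrow> ('h \<Rightarrow> 'h) set" where
  "generated_von_neumann_algebra S = \<Inter>{M. von_neumann_algebra M \<and> S \<subseteq> M}"

section \<open>Positive operator valued measures and spectral measures\<close>

text \<open>A measure space argument \<open>M\<close> is used only for its \<open>\<sigma>\<close>-algebra; the values of an operator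
  valued measure outside \<^term>\<open>sets M\<close> are irrelevant. Finite families are covered by padding
  with empty sets: the constant sequence of empty sets forces \<open>F {} = 0\<close>.\<close>

definition povm :: "'a measure \<Rightarrow> ('a set \<Rightarrow> 'h::complex_hilbert \<Rightarrow> 'h) \<Rightarrow> bool" where
  "povm M F \<longleftrightarrow>
     (\<forall>\<Delta>\<in>sets M. bounded_positive (F \<Delta>))
   \<and> (\<forall>\<Delta>::nat \<Rightarrow> 'a set. range \<Delta> \<subseteq> sets M \<longrightarrow> disjoint_family \<Delta> \<longrightarrow>
        limitin weak_operator_topology (\<lambda>n x. \<Sum>i<n. F (\<Delta> i) x) (F (\<Union>i. \<Delta> i)) sequentially)"

definition pvm :: "'a measure \<Rightarrow> ('a set \<Rightarrow> 'h::complex_hilbert \<Rightarrow> 'h) \<Rightarrow> bool" where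
  "pvm M E \<longleftrightarrow> povm M E \<and> (\<forall>\<Delta>\<in>sets M. orthogonal_projection (E \<Delta>)) \<and> E (space M) = id"

definition scalar_measure ::
    "'a measure \<Rightarrow> ('a set \<Rightarrow> 'h::complex_hilbert \<Rightarrow> 'h) \<Rightarrow> 'h \<Rightarrow> 'a measure" where
  "scalar_measure M E \<psi> = measure_of (space M) (sets M) (\<lambda>\<Delta>. ennreal (Re (cinner (E \<Delta> \<psi>) \<psi>)))"

text \<open>\<open>B = \<integral> g dE\<close> for a bounded measurable real function \<open>g\<close>, in the weak sense. On a
  complex space the quadratic form determines \<open>B\<close>, so \<open>B\<close> is unique.\<close>

definition has_spectral_integral ::
    "'a measure \<Rightarrow> ('a set \<Rightarrow> 'h::complex_hilbert \<Rightarrow> 'h) \<Rightarrow> ('a \<Rightarrow> real) \<Rightarrow> ('h \<Rightarrow> 'h) \<Rightarrow> bool" where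
  "has_spectral_integral M E g B \<longleftrightarrow>
     g \<in> borel_measurable M \<and> bounded (g ` space M) \<and> bounded_clinear B
   \<and> (\<forall>\<psi>. cinner (B \<psi>) \<psi> = complex_of_real (\<integral>t. g t \<partial>scalar_measure M E \<psi>))"

definition spectrum_borel :: "('h::complex_hilbert \<Rightarrow> 'h) \<Rightarrow> real measure" where
  "spectrum_borel A = restrict_space borel (real_spectrum A)"

definition is_spectral_measure ::
    "('h::complex_hilbert \<Rightarrow> 'h) \<Rightarrow> (real set \<Rightarrow> 'h \<Rightarrow> 'h) \<Rightarrow> bool" where
  "is_spectral_measure A E \<longleftrightarrow>
     pvm (spectrum_borel A) E \<and> has_spectral_integral (spectrum_borel A) E (\<lambda>t. t) A"

section \<open>Weak Markov kernels and von Neumann triplets\<close>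

text \<open>The kernel is written \<open>\<mu> \<Delta> t\<close> for \<open>\<mu>\<^sub>\<Delta>(t)\<close>, with \<open>\<Delta>\<close> in the \<open>\<sigma>\<close>-algebra of \<open>N\<close> and \<open>t\<close> in
  the space of \<open>\<nu>\<close>. The first conjunct is the typing of \<open>\<mu>\<close> as a \<open>[0,1]\<close>-valued map, which makes
  the third redundant.\<close>

definition weak_markov_kernel :: "real measure \<Rightarrow> 'x measure \<Rightarrow> ('x set \<Rightarrow> real \<Rightarrow> real) \<Rightarrow> bool" where
  "weak_markov_kernel \<nu> N \<mu> \<longleftrightarrow>
     (\<forall>\<Delta>\<in>sets N. \<forall>t\<in>space \<nu>. \<mu> \<Delta> t \<in> {0..1})
   \<and> (\<forall>\<Delta>\<in>sets N. \<mu> \<Delta> \<in> borel_measurable \<nu>)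
   \<and> (\<forall>\<Delta>\<in>sets N. AE t in \<nu>. 0 \<le> \<mu> \<Delta> t \<and> \<mu> \<Delta> t \<le> 1)
   \<and> (AE t in \<nu>. \<mu> (space N) t = 1 \<and> \<mu> {} t = 0)
   \<and> (\<forall>\<Delta>::nat \<Rightarrow> 'x set. range \<Delta> \<subseteq> sets N \<longrightarrow> disjoint_family \<Delta> \<longrightarrow>
        (AE t in \<nu>. (\<lambda>i. \<mu> (\<Delta> i) t) sums \<mu> (\<Union>i. \<Delta> i) t))"

definition weak_markov_kernel_pvm ::
    "real measure \<Rightarrow> (real set \<Rightarrow> 'h::complex_hilbert \<Rightarrow> 'h) \<Rightarrow> 'x measure \<Rightarrow>
     ('x set \<Rightarrow> real \<Rightarrow> real) \<Rightarrow> bool" where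
  "weak_markov_kernel_pvm M E N \<mu> \<longleftrightarrow> (\<forall>\<psi>. weak_markov_kernel (scalar_measure M E \<psi>) N \<mu>)"

text \<open>\<open>E\<close> is the spectral measure of \<open>A\<close>, so that \<open>has_spectral_integral\<close> expresses
  \<open>F \<Delta> = \<mu>\<^sub>\<Delta>(A)\<close>.\<close>

definition von_neumann_triplet ::
    "(real set \<Rightarrow> 'h::complex_hilbert \<Rightarrow> 'h) \<Rightarrow> ('x::topological_space set \<Rightarrow> 'h \<Rightarrow> 'h) \<Rightarrow> ('h \<Rightarrow> 'h) \<Rightarrow>
     ('x set \<Rightarrow> real \<Rightarrow> real) \<Rightarrow> bool" where
  "von_neumann_triplet E F A \<mu> \<longleftrightarrow>
     (\<forall>\<Delta>\<in>sets borel. has_spectral_integral (spectrum_borel A) E (\<mu> \<Delta>) (F \<Delta>))"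

definition sharp_version ::
    "('h::complex_hilbert \<Rightarrow> 'h) \<Rightarrow> ('x::topological_space set \<Rightarrow> 'h \<Rightarrow> 'h) \<Rightarrow> bool" where
  "sharp_version A F \<longleftrightarrow>
     generated_von_neumann_algebra {A} = generated_von_neumann_algebra (F ` sets borel)"

end

theory Submission
  imports Defs
begin

text \<open>Write \<open>G\<close> for the \<open>\<sigma>\<close>-algebra on the spectrum of \<open>A\<close> generated by the functions \<open>\<mu>\<^sub>\<Delta>\<close>. If
  all \<open>\<mu>\<^sub>\<Delta>\<close> agree at two points, then so does every \<open>G\<close>-measurable function, and so does the
  identity wherever it is a pointwise limit of \<open>G\<close>-measurable functions. It therefore suffices to
  show that \<open>s\<^sub>n(t) \<longrightarrow> t\<close> for \<open>E\<close>-almost all \<open>t\<close>, for some \<open>G\<close>-measurable \<open>s\<^sub>n\<close>; the set \<open>\<Gamma>\<close> consists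
  of points of convergence.

  As \<open>\<H>\<close> is separable, there is a vector \<open>\<omega>\<close> such that \<open>E(B)\<omega> = 0\<close> forces \<open>E(B) = 0\<close>
  (\<open>exists_separating_vector\<close>), so that almost everywhere may be read with respect to
  \<open>\<langle>E(\<cdot>)\<omega>, \<omega>\<rangle>\<close>. Since \<open>\<parallel>(A - s(A))\<omega>\<parallel>\<^sup>2 = \<integral> (t - s(t))\<^sup>2 d\<langle>E\<omega>, \<omega>\<rangle>\<close>, it is enough that \<open>A\<omega>\<close> lies in the
  closed span of \<open>L = {E(B)\<omega> | B \<in> G}\<close>: approximants in the span are \<open>s(A)\<omega>\<close> with \<open>s\<close> a
  \<open>G\<close>-simple function, and mean square convergence gives a subsequence that converges almost
  everywhere (\<open>AE_limit_of_measurable\<close>).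

  This is where the sharpness of \<open>A\<close> enters. The operators that leave both \<open>L\<^sup>\<bottom>\<close> and \<open>L\<^sup>\<bottom>\<^sup>\<bottom>\<close>
  invariant form a von Neumann algebra (\<open>cperp_reducing_von_neumann_algebra\<close>). It contains every
  \<open>F(\<Delta>) = \<mu>\<^sub>\<Delta>(A)\<close>: if \<open>y \<bottom> L\<close>, then the complex measure \<open>\<langle>E(\<cdot>)y, E(B)\<omega>\<rangle>\<close> vanishes on \<open>G\<close>, hence
  so does the integral against it of the \<open>G\<close>-measurable function \<open>\<mu>\<^sub>\<Delta>\<close>
  (\<open>has_spectral_integral_cperp\<close>). Consequently it contains \<open>A\<close>, and \<open>\<omega> \<in> L\<close> yields
  \<open>A\<omega> \<in> L\<^sup>\<bottom>\<^sup>\<bottom>\<close>. Projecting \<open>A\<omega>\<close> orthogonally shows that it is in the closed span of \<open>L\<close>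
  (\<open>in_closure_span_projections\<close>).\<close>

section \<open>Complex inner products and the weak operator topology\<close>

lemma cinner_scaleC_right: "cinner x (c *\<^sub>C y) = cnj c * cinner x y"
  by (metis cinner_commute cinner_scaleC_left complex_cnj_mult complex_cnj_cnj)

lemma Im_cinner: "Im (cinner x y) = inner x (\<i> *\<^sub>C y)"
  by (simp add: Re_cinner[symmetric] cinner_scaleC_right)

lemma cinner_eq_0_iff: "cinner x y = 0 \<longleftrightarrow> inner x y = 0 \<and> inner x (\<i> *\<^sub>C y) = 0"
  by (simp add: complex_eq_iff Im_cinner Re_cinner)

lemma selfadjoint_inner: "bounded_selfadjoint T \<Longrightarrow> inner (T x) y = inner x (T y)"
  by (metis Re_cinner bounded_selfadjoint_def is_adjoint_def)

lemma inner_ii_self: "inner (x::'h::complex_hilbert) (\<i> *\<^sub>C x) = 0"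
  by (metis Im_cinner cinner_commute Im_complex_of_real Reals_cnj_iff complex_is_Real_iff)

text \<open>Complex scalars are essential: replacing \<open>x\<close> by \<open>\<i>x\<close> in the polarized form
  \<open>Im \<langle>Tx, y\<rangle> + Im \<langle>Ty, x\<rangle> = 0\<close> turns imaginary parts into real ones.\<close>

lemma real_quadratic_form_symmetric:
  fixes T :: "'h::complex_hilbert \<Rightarrow> 'h"
  assumes T: "bounded_clinear T" and r: "\<And>x. Im (cinner (T x) x) = 0"
  shows "inner (T x) y = inner x (T y)"
proof -
  interpret T: bounded_linear T
    using T by (simp add: bounded_clinear_def)
  have C: "T (c *\<^sub>C x) = c *\<^sub>C T x" for c x
    using T by (simp add: bounded_clinear_def)
  have 1: "Im (cinner (T (x + y)) (x + y)) = 0" for x y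
    by (rule r)
  have adR: "cinner a (b + c) = cinner a b + cinner a c" for a b c :: 'h
    by (metis cinner_add_left cinner_commute complex_cnj_add)
  have 2: "Im (cinner (T x) y) + Im (cinner (T y) x) = 0" for x y
    using 1[of x y] by (simp add: T.add cinner_add_left adR r)
  have "Re (cinner (T x) y) = Re (cinner (T y) x)"
    using 2[of "\<i> *\<^sub>C x" y] by (simp add: C cinner_scaleC_left cinner_scaleC_right)
  then show ?thesis
    by (simp add: Re_cinner inner_commute)
qed

lemma continuous_map_matrix_coefficient:
  "continuous_map weak_operator_topology euclidean (\<lambda>T. cinner (T x) y)"
proof -
  have "continuous_map euclidean euclidean (\<lambda>h::'a \<times> 'a \<Rightarrow> complex. h (x, y))"
    by simp
  from continuous_map_pullback[OF this, of "Collect bounded_clinear" "\<lambda>T (x, y). cinner (T x) y"]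
  show ?thesis
    by (simp add: weak_operator_topology_def o_def)
qed

lemma limitin_weak_operator_topology_inner:
  assumes "limitin weak_operator_topology T S sequentially"
  shows "(\<lambda>n. inner (T n x) y) \<longlonglongrightarrow> inner (S x) y"
proof -
  have "(\<lambda>n. cinner (T n x) y) \<longlonglongrightarrow> cinner (S x) y"
    using continuous_map_limit[OF continuous_map_matrix_coefficient[of x y] assms]
    by (simp add: o_def)
  from tendsto_Re[OF this] show ?thesis
    by (simp add: Re_cinner)
qed

section \<open>Orthogonal projection onto a closed subspace\<close>

text \<open>A minimizing sequence for the distance from \<open>x\<close> to \<open>K\<close> is Cauchy by the parallelogram law, and
  its limit minimizes the distance. If the residual had a component along some \<open>b \<in> K\<close>, removing
  it would shorten the distance further.\<close>

lemma orthogonal_projection_exists: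
  fixes x :: "'h::{real_inner, complete_space}"
  assumes K: "subspace K" "closed K"
  shows "\<exists>p\<in>K. \<forall>b\<in>K. inner (x - p) b = 0"
proof -
  define d where "d = Inf ((\<lambda>p. (norm (x - p))\<^sup>2) ` K)"
  have ne: "K \<noteq> {}" and bdd: "bdd_below ((\<lambda>p. (norm (x - p))\<^sup>2) ` K)"
    using subspace_0[OF K(1)] by (auto intro!: bdd_belowI[of _ 0])
  have d_le: "d \<le> (norm (x - p))\<^sup>2" if "p \<in> K" for p
    unfolding d_def using that bdd by (intro cInf_lower) auto
  have "\<exists>p\<in>K. (norm (x - p))\<^sup>2 < d + 1 / Suc n" for n :: nat
    using cInf_less_iff[of "(\<lambda>p. (norm (x - p))\<^sup>2) ` K" "d + 1 / Suc n"] ne bdd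
    by (auto simp: d_def)
  then obtain p where p: "p n \<in> K" "(norm (x - p n))\<^sup>2 < d + 1 / Suc n" for n
    by metis
  have par: "(norm (p m - p n))\<^sup>2 \<le> 2 / Suc m + 2 / Suc n" for m n
  proof -
    have "(1/2) *\<^sub>R (p m + p n) \<in> K"
      by (intro subspace_scale subspace_add K p)
    then have "d \<le> (norm (x - (1/2) *\<^sub>R (p m + p n)))\<^sup>2"
      by (rule d_le)
    moreover have "(norm (p m - p n))\<^sup>2
        = 2 * (norm (x - p m))\<^sup>2 + 2 * (norm (x - p n))\<^sup>2 - 4 * (norm (x - (1/2) *\<^sub>R (p m + p n)))\<^sup>2"
      by (simp add: power2_norm_eq_inner algebra_simps inner_commute)
    ultimately show ?thesis
      using p(2)[of m] p(2)[of n] by simp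
  qed
  have "Cauchy p"
  proof (rule metric_CauchyI)
    fix e :: real assume e: "e > 0"
    then obtain N where N: "1 / real (Suc N) < e\<^sup>2 / 4"
      using nat_approx_posE[of "e\<^sup>2 / 4"] by auto
    have "dist (p m) (p n) < e" if "m \<ge> N" "n \<ge> N" for m n
    proof -
      have "1 / real (Suc m) \<le> 1 / real (Suc N)" "1 / real (Suc n) \<le> 1 / real (Suc N)"
        using that by (auto simp: frac_le)
      then have "(norm (p m - p n))\<^sup>2 < e\<^sup>2"
        using par[of m n] N by simp
      then show ?thesis
        using e by (simp add: dist_norm power_less_imp_less_base)
    qed
    then show "\<exists>M. \<forall>m\<ge>M. \<forall>n\<ge>M. dist (p m) (p n) < e"
      by blast
  qed
  then obtain q where q: "p \<longlonglongrightarrow> q"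
    using Cauchy_convergent convergent_def by blast
  have qK: "q \<in> K"
    using closed_sequentially[OF K(2) _ q] p(1) by blast
  have qd: "(norm (x - q))\<^sup>2 \<le> d"
  proof (rule LIMSEQ_le)
    show "(\<lambda>n. (norm (x - p n))\<^sup>2) \<longlonglongrightarrow> (norm (x - q))\<^sup>2"
      by (intro tendsto_intros q)
    show "(\<lambda>n. d + 1 / real (Suc n)) \<longlonglongrightarrow> d"
      using tendsto_add[OF tendsto_const LIMSEQ_inverse_real_of_nat, of d]
      by (simp add: inverse_eq_divide)
  qed (use p(2) less_imp_le in blast)
  have "inner (x - q) b = 0" if b: "b \<in> K" for b
  proof (rule ccontr)
    let ?c = "inner (x - q) b"
    assume c: "?c \<noteq> 0"
    then have bp: "inner b b > 0"
      by auto
    \<comment> \<open>the value of \<open>t\<close> that minimizes the distance from \<open>x\<close> to \<open>q + t b\<close>\<close>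
    let ?t = "?c / inner b b"
    have "q + ?t *\<^sub>R b \<in> K"
      by (intro subspace_add subspace_scale K qK b)
    have expand: "(norm (x - (q + t *\<^sub>R b)))\<^sup>2 = (norm (x - q))\<^sup>2 - 2 * t * ?c + t\<^sup>2 * inner b b" for t
      unfolding power2_norm_eq_inner by (simp add: algebra_simps inner_commute power2_eq_square)
    from d_le[OF \<open>q + ?t *\<^sub>R b \<in> K\<close>] have "d \<le> (norm (x - q))\<^sup>2 - 2 * ?t * ?c + ?t\<^sup>2 * inner b b"
      by (simp only: expand)
    also have "\<dots> = (norm (x - q))\<^sup>2 - ?c\<^sup>2 / inner b b"
      using bp by (simp add: field_simps power2_eq_square)
    finally have "?c\<^sup>2 / inner b b \<le> 0"
      using qd by simp
    then show False
      using c bp by (simp add: divide_le_0_iff)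
  qed
  then show ?thesis
    using qK by blast
qed

section \<open>Biorthogonal subspaces\<close>

text \<open>The complex orthogonal complement. For the real inner product alone, the complement of a set of
  vectors need not be closed under multiplication by \<open>\<i>\<close>.\<close>

definition cperp :: "'h::complex_hilbert set \<Rightarrow> 'h set" where
  "cperp L = {y. \<forall>b\<in>L. cinner y b = 0}"

lemma cinner_eq_0_commute: "cinner x y = 0 \<longleftrightarrow> cinner y x = 0"
  by (metis cinner_commute complex_cnj_zero)

text \<open>Everything follows from the fact that both subspaces are defined by equations \<open>\<langle>x, b\<rangle> = 0\<close>. Such
  conditions on \<open>T x\<close> are closed in the weak operator topology, and the two invariance conditions
  are exchanged by taking adjoints. Asking for the invariance of \<open>L\<^sup>\<bottom>\<close> and \<open>L\<^sup>\<bottom>\<^sup>\<bottom>\<close>, rather than for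
  commutation with the projection onto one of them, avoids orthogonal decompositions.\<close>

lemma cperp_reducing_von_neumann_algebra:
  fixes L :: "'h::complex_hilbert set"
  defines "M \<equiv> {T. bounded_clinear T \<and> T ` cperp L \<subseteq> cperp L
                    \<and> T ` cperp (cperp L) \<subseteq> cperp (cperp L)}"
  shows "von_neumann_algebra M"
proof -
  have add: "x + y \<in> cperp S" if "x \<in> cperp S" "y \<in> cperp S" for x y and S :: "'h set"
    using that by (auto simp: cperp_def cinner_add_left)
  have sc: "c *\<^sub>C x \<in> cperp S" if "x \<in> cperp S" for x c and S :: "'h set"
    using that by (auto simp: cperp_def cinner_scaleC_left)
  have bid: "bounded_clinear id"
    by (simp add: bounded_clinear_def bounded_linear_ident id_def)
  have badd: "bounded_clinear (\<lambda>x. S x + T x)" if "bounded_clinear S" "bounded_clinear T" for S T :: "'h \<Rightarrow> 'h"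
    using that by (simp add: bounded_clinear_def bounded_linear_add scaleC_add_right)
  have bsc: "bounded_clinear (\<lambda>x. c *\<^sub>C T x)" if "bounded_clinear T" for c and T :: "'h \<Rightarrow> 'h"
  proof -
    have "bounded_linear (\<lambda>x::'h. c *\<^sub>C x)"
    proof (rule bounded_linear_intro)
      fix r :: real and x :: 'h
      show "c *\<^sub>C r *\<^sub>R x = r *\<^sub>R c *\<^sub>C x"
        by (simp add: scaleC_of_real[symmetric] scaleC_scaleC mult.commute)
      have "cinner (c *\<^sub>C x) (c *\<^sub>C x) = complex_of_real ((cmod c)\<^sup>2) * cinner x x"
        by (simp add: cinner_scaleC_left cinner_scaleC_right mult_ac flip: complex_norm_square)
      then have "(norm (c *\<^sub>C x))\<^sup>2 = (norm x * cmod c)\<^sup>2"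
        by (simp add: power2_norm_eq_inner Re_cinner[symmetric] power_mult_distrib)
      then show "norm (c *\<^sub>C x) \<le> norm x * cmod c"
        by (metis norm_ge_zero mult_nonneg_nonneg power2_eq_iff_nonneg order_refl)
    qed (rule scaleC_add_right)
    then show ?thesis
      using that by (auto simp: bounded_clinear_def scaleC_scaleC mult.commute
          intro: bounded_linear_compose)
  qed
  have bcomp: "bounded_clinear (S \<circ> T)" if "bounded_clinear S" "bounded_clinear T" for S T :: "'h \<Rightarrow> 'h"
    using that by (auto simp: bounded_clinear_def o_def intro: bounded_linear_compose)
  have adj: "S \<in> M" if T: "T \<in> M" and ST: "is_adjoint S T" for S T
  proof -
    have S: "cinner (S x) y = cinner x (T y)" for x y
      using ST by (metis cinner_commute is_adjoint_def)
    have LL: "b \<in> cperp (cperp L)" if "b \<in> L" for b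
      using that by (auto simp: cperp_def cinner_eq_0_commute)
    have "S y \<in> cperp L" if "y \<in> cperp L" for y
    proof -
      have "cinner (S y) b = 0" if "b \<in> L" for b
        using T LL[OF that] \<open>y \<in> cperp L\<close>
        by (auto simp: M_def S cperp_def[of "cperp L"] cinner_eq_0_commute[of y])
      then show ?thesis by (simp add: cperp_def)
    qed
    moreover have "S x \<in> cperp (cperp L)" if "x \<in> cperp (cperp L)" for x
      using T that by (auto simp: M_def S cperp_def[of "cperp L"])
    ultimately show ?thesis
      using ST by (auto simp: M_def is_adjoint_def)
  qed
  have "closedin weak_operator_topology M"
  proof -
    have top: "topspace weak_operator_topology = (Collect bounded_clinear :: ('h \<Rightarrow> 'h) set)"
      by (simp add: weak_operator_topology_def topspace_pullback_topology)
    have cl: "closedin weak_operator_topology {T. bounded_clinear T \<and> cinner (T x) y = 0}" for x y :: 'h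
      using closedin_continuous_map_preimage[OF continuous_map_matrix_coefficient[of x y], of "{0}"]
      by (simp add: top)
    have img: "T ` U \<subseteq> cperp S \<longleftrightarrow> (\<forall>x\<in>U. \<forall>b\<in>S. cinner (T x) b = 0)" for T and U S :: "'h set"
      by (auto simp: cperp_def)
    have "M = \<Inter>(insert (topspace weak_operator_topology)
        ((\<lambda>(x, y). {T. bounded_clinear T \<and> cinner (T x) y = 0})
           ` (cperp L \<times> L \<union> cperp (cperp L) \<times> cperp L)))"
      by (auto simp: M_def top img)
    also have "closedin weak_operator_topology \<dots>"
      using cl by (intro closedin_Inter) auto
    finally show ?thesis .
  qed
  moreover have mem: "T \<in> M \<longleftrightarrow> bounded_clinear T \<and> (\<forall>x\<in>cperp L. T x \<in> cperp L)
      \<and> (\<forall>x\<in>cperp (cperp L). T x \<in> cperp (cperp L))" for T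
    by (auto simp: M_def)
  have "M \<subseteq> Collect bounded_clinear" "id \<in> M"
    "\<forall>S\<in>M. \<forall>T\<in>M. (\<lambda>x. S x + T x) \<in> M"
    "\<forall>c. \<forall>T\<in>M. (\<lambda>x. c *\<^sub>C T x) \<in> M"
    "\<forall>S\<in>M. \<forall>T\<in>M. S \<circ> T \<in> M"
    by (auto simp: mem bid badd bsc bcomp add sc)
  ultimately show ?thesis
    using adj by (auto simp: von_neumann_algebra_def)
qed

section \<open>Scalar measures\<close>

lemma povm_inner_LIMSEQ:
  assumes "povm M F" "range D \<subseteq> sets M" "disjoint_family D"
  shows "(\<lambda>n. \<Sum>i<n. inner (F (D i) x) y) \<longlonglongrightarrow> inner (F (\<Union>i. D i) x) y"
  using assms limitin_weak_operator_topology_inner[of "\<lambda>n x. \<Sum>i<n. F (D i) x" "F (\<Union>i. D i)" x y]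
  by (auto simp: povm_def inner_sum_left)

text \<open>Countable additivity for the constant sequence of empty sets makes \<open>n \<sqdot> F {}\<close> converge.\<close>

lemma povm_empty_inner:
  assumes "povm M F"
  shows "inner (F {} x) y = 0"
proof -
  let ?a = "inner (F {} x) y"
  have l: "(\<lambda>n. real n * ?a) \<longlonglongrightarrow> ?a"
    using povm_inner_LIMSEQ[OF assms, of "\<lambda>_. {}" x y] by (simp add: disjoint_family_on_def)
  have "(\<lambda>n. real (Suc n) * ?a - real n * ?a) \<longlonglongrightarrow> ?a - ?a"
    using tendsto_diff[OF LIMSEQ_Suc[OF l] l] .
  then have "(\<lambda>n::nat. ?a) \<longlonglongrightarrow> 0"
    by (simp add: algebra_simps)
  then show ?thesis
    by (simp add: LIMSEQ_const_iff)
qed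

lemma emeasure_scalar_measure:
  assumes F: "povm M F" and B: "B \<in> sets M"
  shows "emeasure (scalar_measure M F x) B = ennreal (inner (F B x) x)"
proof -
  have nn: "0 \<le> inner (F C x) x" if "C \<in> sets M" for C
    using F that by (auto simp: povm_def bounded_positive_def Re_cinner)
  show ?thesis
  proof (rule emeasure_measure_of[where \<Omega> = "space M" and A = "sets M"
        and \<mu> = "\<lambda>B. ennreal (inner (F B x) x)"])
    show "scalar_measure M F x = measure_of (space M) (sets M) (\<lambda>B. ennreal (inner (F B x) x))"
      by (simp add: scalar_measure_def Re_cinner)
    show "positive (sets (scalar_measure M F x)) (\<lambda>B. ennreal (inner (F B x) x))"
      by (simp add: positive_def povm_empty_inner[OF F])
    show "countably_additive (sets (scalar_measure M F x)) (\<lambda>B. ennreal (inner (F B x) x))"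
    proof (rule countably_additiveI)
      fix D :: "nat \<Rightarrow> 'a set"
      assume "range D \<subseteq> sets (scalar_measure M F x)" and dis: "disjoint_family D"
      then have D: "range D \<subseteq> sets M"
        by (simp add: scalar_measure_def sets.sigma_sets_eq sets.space_closed)
      have "(\<lambda>n. \<Sum>i<n. ennreal (inner (F (D i) x) x)) \<longlonglongrightarrow> ennreal (inner (F (\<Union>i. D i) x) x)"
        using tendsto_ennrealI[OF povm_inner_LIMSEQ[OF F D dis, of x x]] D nn
        by (subst sum_ennreal) (auto simp: range_subsetD)
      then show "(\<Sum>i. ennreal (inner (F (D i) x) x)) = ennreal (inner (F (\<Union>i. D i) x) x)"
        by (simp add: sums_def sums_unique[symmetric])
    qed
  qed (use B sets.space_closed in \<open>auto simp: scalar_measure_def sets.sigma_sets_eq sets.space_closed\<close>)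
qed

lemma space_scalar_measure [simp]: "space (scalar_measure M E x) = space M"
  by (simp add: scalar_measure_def sets.space_closed)

lemma sets_scalar_measure [simp, measurable_cong]: "sets (scalar_measure M E x) = sets M"
  by (simp add: scalar_measure_def sets.sigma_sets_eq sets.space_closed)

lemma measurable_scalar_measure [simp]: "measurable (scalar_measure M E x) N = measurable M N"
  by (rule measurable_cong_sets) auto

context
  fixes M :: "'a measure" and E :: "'a set \<Rightarrow> 'h::complex_hilbert \<Rightarrow> 'h"
  assumes pvm: "pvm M E"
begin

lemma pvm_povm: "povm M E"
  using pvm by (simp add: pvm_def)

lemma pvm_clinear: "B \<in> sets M \<Longrightarrow> bounded_clinear (E B)"
  using pvm by (auto simp: pvm_def orthogonal_projection_def bounded_selfadjoint_def is_adjoint_def)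

lemma pvm_linear: "B \<in> sets M \<Longrightarrow> bounded_linear (E B)"
  using pvm_clinear by (auto simp: bounded_clinear_def)

lemma pvm_inner_commute: "B \<in> sets M \<Longrightarrow> inner (E B x) y = inner x (E B y)"
  using pvm by (intro selfadjoint_inner) (auto simp: pvm_def orthogonal_projection_def)

lemma pvm_idem: "B \<in> sets M \<Longrightarrow> E B (E B x) = E B x"
  using pvm by (auto simp: pvm_def orthogonal_projection_def o_def dest!: bspec fun_cong)

lemma pvm_space: "E (space M) x = x"
  using pvm by (simp add: pvm_def)

lemma pvm_inner_self: "B \<in> sets M \<Longrightarrow> inner (E B x) x = (norm (E B x))\<^sup>2"
  by (metis pvm_idem pvm_inner_commute power2_norm_eq_inner)

lemma measure_pvm: "B \<in> sets M \<Longrightarrow> measure (scalar_measure M E x) B = inner (E B x) x"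
  by (simp add: measure_def emeasure_scalar_measure[OF pvm_povm] pvm_inner_self)

lemma emeasure_pvm: "B \<in> sets M \<Longrightarrow> emeasure (scalar_measure M E x) B = ennreal ((norm (E B x))\<^sup>2)"
  by (simp add: emeasure_scalar_measure[OF pvm_povm] pvm_inner_self)

lemma finite_scalar_measure: "finite_measure (scalar_measure M E x)"
  by (rule finite_measureI) (simp add: emeasure_pvm)

lemma pvm_null_iff: "B \<in> sets M \<Longrightarrow> B \<in> null_sets (scalar_measure M E x) \<longleftrightarrow> E B x = 0"
  by (simp add: null_sets_def emeasure_pvm)

lemma pvm_norm_le: "B \<in> sets M \<Longrightarrow> norm (E B x) \<le> norm x"
  using norm_cauchy_schwarz[of "E B x" x] pvm_inner_self[of B x]
  by (cases "norm (E B x) = 0") (auto simp: power2_eq_square)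

text \<open>For symmetric operators the real polarization identity is enough to recover the operator from
  its quadratic form.\<close>

lemma pvm_eqI:
  assumes B: "B \<in> sets M" and S: "bounded_linear S" "\<And>x y. inner (S x) y = inner x (S y)"
    and eq: "\<And>x. inner (E B x) x = inner (S x) x"
  shows "E B x = S x"
proof -
  interpret E: bounded_linear "E B" by (rule pvm_linear[OF B])
  interpret S: bounded_linear S by (rule S)
  have "inner (E B x) y = inner (S x) y" for y
  proof -
    have "2 * inner (E B x) y = inner (E B (x + y)) (x + y) - inner (E B x) x - inner (E B y) y"
      using pvm_inner_commute[OF B, of y x] by (simp add: E.add inner_add inner_commute)
    also have "\<dots> = inner (S (x + y)) (x + y) - inner (S x) x - inner (S y) y"
      by (simp only: eq)
    also have "\<dots> = 2 * inner (S x) y"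
      using S(2)[of y x] by (simp add: S.add inner_add inner_commute)
    finally show ?thesis by simp
  qed
  then show ?thesis
    by (metis vector_eq_rdot inner_commute)
qed

lemma pvm_union_disjoint:
  assumes B: "B \<in> sets M" and C: "C \<in> sets M" and d: "B \<inter> C = {}"
  shows "E (B \<union> C) x = E B x + E C x"
proof (rule pvm_eqI)
  show "bounded_linear (\<lambda>x. E B x + E C x)"
    by (intro bounded_linear_add pvm_linear B C)
  interpret finite_measure "scalar_measure M E x" for x
    by (rule finite_scalar_measure)
  show "inner (E (B \<union> C) x) x = inner (E B x + E C x) x" for x
    using finite_measure_Union[of B x C] B C d by (simp add: measure_pvm inner_add)
qed (use B C in \<open>auto simp: pvm_inner_commute inner_add\<close>)

text \<open>With \<open>z = E C x\<close>, additivity gives \<open>\<parallel>E B z\<parallel>\<^sup>2 + \<parallel>z\<parallel>\<^sup>2 = \<parallel>E (B \<union> C) z\<parallel>\<^sup>2 \<le> \<parallel>z\<parallel>\<^sup>2\<close>.\<close>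

lemma pvm_disjoint:
  assumes B: "B \<in> sets M" and C: "C \<in> sets M" and d: "B \<inter> C = {}"
  shows "E B (E C x) = 0"
proof -
  let ?z = "E C x"
  have "(norm (E B ?z))\<^sup>2 + (norm ?z)\<^sup>2 = inner (E (B \<union> C) ?z) ?z"
    by (simp add: pvm_union_disjoint[OF B C d] inner_add pvm_inner_self B C pvm_idem power2_norm_eq_inner[of ?z])
  also have "\<dots> \<le> (norm ?z)\<^sup>2"
    using B C by (simp add: pvm_inner_self pvm_norm_le)
  finally show ?thesis
    by simp
qed

lemma pvm_Int:
  assumes B: "B \<in> sets M" and C: "C \<in> sets M"
  shows "E B (E C x) = E (B \<inter> C) x"
proof -
  have 1: "E B y = E (B \<inter> C) y + E (B - C) y" for y
    using pvm_union_disjoint[of "B \<inter> C" "B - C" y] B C by (simp add: Int_Diff_Un Int_Diff_disjoint)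
  have 2: "E C x = E (B \<inter> C) x + E (C - B) x"
    using pvm_union_disjoint[of "C \<inter> B" "C - B" x] B C
    by (simp add: Int_Diff_Un Int_Diff_disjoint Int_commute[of B C])
  interpret bounded_linear "E (B \<inter> C)"
    using B C by (intro pvm_linear) auto
  have "E B (E C x) = E (B \<inter> C) (E C x)"
    using 1[of "E C x"] pvm_disjoint[of "B - C" C x] B C by auto
  also have "\<dots> = E (B \<inter> C) x"
    using B C pvm_disjoint[of "B \<inter> C" "C - B" x] by (subst 2) (auto simp: add pvm_idem)
  finally show ?thesis .
qed

lemma pvm_mono_null:
  assumes "B \<in> sets M" "C \<in> sets M" "C \<subseteq> B" "E B x = 0"
  shows "E C x = 0"
  using pvm_Int[of C B x] assms linear_0[OF bounded_linear.linear[OF pvm_linear[of C]]]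
  by (simp add: Int_absorb2)

end

section \<open>Spectral integrals\<close>

text \<open>On \<open>G\<close> the signed measure \<open>P - Q\<close> has density \<open>w\<close> with respect to \<open>R\<close>, and this is transported
  from indicators to bounded \<open>G\<close>-measurable \<open>f\<close>. The three measures are kept apart because the
  polarization identity produces a difference of two positive measures. Only \<open>f\<close> has to be
  measurable with respect to the smaller \<open>\<sigma>\<close>-algebra.\<close>

lemma integral_diff_eq_weighted_integral:
  fixes f w :: "'a \<Rightarrow> real"
  assumes fin: "finite_measure P" "finite_measure Q" "finite_measure R"
    and sets_eq [measurable_cong]: "sets P = sets M" "sets Q = sets M" "sets R = sets M"
    and G: "space G = space M" "sets G \<subseteq> sets M"
    and w [measurable]: "w \<in> borel_measurable M" and wK: "\<And>t. t \<in> space M \<Longrightarrow> \<bar>w t\<bar> \<le> K"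
    and f: "f \<in> borel_measurable G" and fL: "\<And>t. t \<in> space M \<Longrightarrow> \<bar>f t\<bar> \<le> L"
    and eq: "\<And>C. C \<in> sets G \<Longrightarrow> measure P C - measure Q C = (\<integral>t. indicator C t * w t \<partial>R)"
  shows "(\<integral>t. f t \<partial>P) - (\<integral>t. f t \<partial>Q) = (\<integral>t. f t * w t \<partial>R)"
proof -
  interpret P: finite_measure P by fact
  interpret Q: finite_measure Q by fact
  interpret R: finite_measure R by fact
  have sp: "space P = space M" "space Q = space M" "space R = space M"
    using sets_eq by (auto dest: sets_eq_imp_space_eq)
  have GM: "u \<in> borel_measurable M" if "u \<in> borel_measurable G" for u :: "'a \<Rightarrow> real"
    using that G by (auto simp: measurable_def)
  have int: "integrable P u" "integrable Q u" "integrable R (\<lambda>t. u t * w t)"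
    if "u \<in> borel_measurable G" "\<And>t. t \<in> space M \<Longrightarrow> \<bar>u t\<bar> \<le> c" for u :: "'a \<Rightarrow> real" and c
  proof -
    have [measurable]: "u \<in> borel_measurable M"
      by (rule GM[OF that(1)])
    show "integrable P u" "integrable Q u"
      using that(2) by (auto intro!: P.integrable_const_bound[of _ c] Q.integrable_const_bound[of _ c] AE_I2 simp: sp)
    have "\<bar>u t * w t\<bar> \<le> c * K" if "t \<in> space M" for t
      unfolding abs_mult using \<open>\<And>t. t \<in> space M \<Longrightarrow> \<bar>u t\<bar> \<le> c\<close>[OF that] wK[OF that]
      by (intro mult_mono) auto
    then show "integrable R (\<lambda>t. u t * w t)"
      by (intro R.integrable_const_bound[of _ "c * K"] AE_I2) (auto simp: sp)
  qed
  have pos: "(\<exists>c. \<forall>t\<in>space M. u t \<le> c) \<longrightarrow> (\<integral>t. u t \<partial>P) - (\<integral>t. u t \<partial>Q) = (\<integral>t. u t * w t \<partial>R)"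
    if "u \<in> borel_measurable G" "\<And>t. 0 \<le> u t" for u
    using that
  proof (induction rule: borel_measurable_induct_real)
    case (set C)
    then have "C \<in> sets M" "C \<subseteq> space M"
      using G sets.sets_into_space[OF set] by auto
    then show ?case
      using eq[OF set] by (simp add: sets_eq sp Int_absorb2)
  next
    case (mult u c)
    show ?case
    proof (cases "c = 0")
      case False
      show ?thesis
      proof
        assume "\<exists>d. \<forall>t\<in>space M. c * u t \<le> d"
        then obtain d where "\<forall>t\<in>space M. c * u t \<le> d" ..
        then have "\<forall>t\<in>space M. u t \<le> d / c"
          using False mult.hyps(1) by (simp add: field_simps)
        then have "(\<integral>t. u t \<partial>P) - (\<integral>t. u t \<partial>Q) = (\<integral>t. u t * w t \<partial>R)"
          using mult by blast
        then show "(\<integral>t. c * u t \<partial>P) - (\<integral>t. c * u t \<partial>Q) = (\<integral>t. c * u t * w t \<partial>R)"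
          by (simp add: mult.assoc flip: right_diff_distrib)
      qed
    qed simp
  next
    case (add u v)
    show ?case
    proof
      assume "\<exists>d. \<forall>t\<in>space M. v t + u t \<le> d"
      then obtain d where d: "v t + u t \<le> d" if "t \<in> space M" for t by blast
      have u: "u t \<le> d" and v: "v t \<le> d" if "t \<in> space M" for t
        using d[OF that] add.hyps(2)[of t] add.hyps(4)[of t] by auto
      have "\<bar>u t\<bar> \<le> d" "\<bar>v t\<bar> \<le> d" if "t \<in> space M" for t
        using u[OF that] v[OF that] add.hyps(2)[of t] add.hyps(4)[of t] by auto
      note i = int[OF add.hyps(1) this(1)] int[OF add.hyps(3) this(2)]
      have "(\<integral>t. u t \<partial>P) - (\<integral>t. u t \<partial>Q) = (\<integral>t. u t * w t \<partial>R)"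
        "(\<integral>t. v t \<partial>P) - (\<integral>t. v t \<partial>Q) = (\<integral>t. v t * w t \<partial>R)"
        using add.IH u v by blast+
      then show "(\<integral>t. v t + u t \<partial>P) - (\<integral>t. v t + u t \<partial>Q) = (\<integral>t. (v t + u t) * w t \<partial>R)"
        using i by (simp add: distrib_right)
    qed
  next
    case (seq U)
    show ?case
    proof
      assume "\<exists>d. \<forall>t\<in>space M. u t \<le> d"
      then obtain d where d: "u t \<le> d" if "t \<in> space M" for t by blast
      have Ud: "\<bar>U i t\<bar> \<le> d" if "t \<in> space M" for t i
      proof -
        have "U i t \<le> u t"
          using seq.hyps(3) seq.hyps(4)[of t] that G
          by (intro incseq_le[of "\<lambda>i. U i t"]) (auto simp: incseq_def le_fun_def)
        then show ?thesis
          using seq.hyps(2)[of i t] d[OF that] by simp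
      qed
      have [measurable]: "U i \<in> borel_measurable M" "u \<in> borel_measurable M" for i
        using seq.hyps(1) that(1) by (auto intro: GM)
      have each: "(\<integral>t. U i t \<partial>P) - (\<integral>t. U i t \<partial>Q) = (\<integral>t. U i t * w t \<partial>R)" for i
      proof -
        have "\<forall>t\<in>space M. U i t \<le> d"
          using Ud[of _ i] by (auto dest: abs_le_D1)
        then show ?thesis
          using seq.IH[of i] by blast
      qed
      have conv: "(\<lambda>i. U i t) \<longlonglongrightarrow> u t" if "t \<in> space M" for t
        using seq.hyps(4)[of t] that G by simp
      have ae: "AE t in S. (\<lambda>i. U i t) \<longlonglongrightarrow> u t" "AE t in S. \<bar>U i t\<bar> \<le> d"
        if "space S = space M" for S i
        using conv Ud that by (intro AE_I2; simp)+
      have limP: "(\<lambda>i. \<integral>t. U i t \<partial>P) \<longlonglongrightarrow> (\<integral>t. u t \<partial>P)"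
        by (rule integral_dominated_convergence[where w = "\<lambda>_. d"])
          (simp_all add: ae sp)
      have limQ: "(\<lambda>i. \<integral>t. U i t \<partial>Q) \<longlonglongrightarrow> (\<integral>t. u t \<partial>Q)"
        by (rule integral_dominated_convergence[where w = "\<lambda>_. d"])
          (simp_all add: ae sp)
      have limR: "(\<lambda>i. \<integral>t. U i t * w t \<partial>R) \<longlonglongrightarrow> (\<integral>t. u t * w t \<partial>R)"
      proof (rule integral_dominated_convergence[where w = "\<lambda>_. d * K"])
        show "AE t in R. norm (U i t * w t) \<le> d * K" for i
        proof (rule AE_I2)
          fix t assume "t \<in> space R"
          then have t: "t \<in> space M"
            by (simp add: sp)
          then have "\<bar>U i t\<bar> * \<bar>w t\<bar> \<le> d * K"
            by (intro mult_mono Ud wK order_trans[OF abs_ge_zero Ud[OF t]]) auto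
          then show "norm (U i t * w t) \<le> d * K"
            by (simp add: abs_mult)
        qed
        show "AE t in R. (\<lambda>i. U i t * w t) \<longlonglongrightarrow> u t * w t"
          using conv by (intro AE_I2 tendsto_mult_right) (simp add: sp)
      qed simp_all
      show "(\<integral>t. u t \<partial>P) - (\<integral>t. u t \<partial>Q) = (\<integral>t. u t * w t \<partial>R)"
        using tendsto_diff[OF limP limQ] limR by (simp only: each LIMSEQ_unique)
    qed
  qed
  \<comment> \<open>a shift reduces the claim to nonnegative functions; outside the space \<open>f\<close> is unconstrained\<close>
  let ?f = "\<lambda>t. (f t + L) * indicator (space M) t"
  have f_shift: "?f t = f t + L" if "t \<in> space M" for t
    using that by simp
  have nn: "0 \<le> ?f t" and le: "?f t \<le> \<bar>2 * L\<bar>" for t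
    using fL[of t] by (auto simp: indicator_def)
  have "?f \<in> borel_measurable G"
    using f unfolding G(1)[symmetric] by measurable
  from pos[OF this nn] le have "(\<integral>t. ?f t \<partial>P) - (\<integral>t. ?f t \<partial>Q) = (\<integral>t. ?f t * w t \<partial>R)"
    by blast
  moreover note i = int[OF f fL]
  have "(\<integral>t. ?f t \<partial>P) = (\<integral>t. f t + L \<partial>P)" "(\<integral>t. ?f t \<partial>Q) = (\<integral>t. f t + L \<partial>Q)"
    "(\<integral>t. ?f t * w t \<partial>R) = (\<integral>t. f t * w t + L * w t \<partial>R)"
    by (intro Bochner_Integration.integral_cong; simp add: sp distrib_right)+
  moreover have "(\<integral>t. f t + L \<partial>P) = (\<integral>t. f t \<partial>P) + L * measure P (space M)"
    "(\<integral>t. f t + L \<partial>Q) = (\<integral>t. f t \<partial>Q) + L * measure Q (space M)"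
    using i by (simp_all add: sp)
  moreover have "integrable R w"
    using wK by (intro R.integrable_const_bound[of _ K] AE_I2) (auto simp: sp)
  then have "(\<integral>t. f t * w t + L * w t \<partial>R) = (\<integral>t. f t * w t \<partial>R) + L * (\<integral>t. w t \<partial>R)"
    using i by simp
  moreover have "measure P (space M) - measure Q (space M) = (\<integral>t. w t \<partial>R)"
  proof -
    have "(\<integral>t. indicator (space M) t * w t \<partial>R) = (\<integral>t. w t \<partial>R)"
      by (intro Bochner_Integration.integral_cong) (auto simp: sp)
    then show ?thesis
      using eq[of "space M"] G(1) sets.top[of G] by simp
  qed
  then have "L * measure P (space M) - L * measure Q (space M) = L * (\<integral>t. w t \<partial>R)"
    by (simp flip: right_diff_distrib)
  ultimately show ?thesis
    by linarith
qed

context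
  fixes M :: "'a measure" and E :: "'a set \<Rightarrow> 'h::complex_hilbert \<Rightarrow> 'h"
  assumes pvm: "pvm M E"
begin

lemma has_spectral_integral_symmetric:
  assumes "has_spectral_integral M E f T"
  shows "inner (T x) y = inner x (T y)"
  using assms by (intro real_quadratic_form_symmetric) (auto simp: has_spectral_integral_def)

lemma has_spectral_integral_inner_self:
  assumes "has_spectral_integral M E f T"
  shows "inner (T x) x = (\<integral>t. f t \<partial>scalar_measure M E x)"
  using assms by (simp add: has_spectral_integral_def flip: Re_cinner)

text \<open>The identity \<open>\<langle>Tu, v\<rangle> = \<integral> f d\<langle>Eu, v\<rangle>\<close> in a form that needs no complex measures: it is applied
  when \<open>\<langle>E u, v\<rangle>\<close> is known to have density \<open>w\<close> with respect to \<open>\<langle>E x, x\<rangle>\<close>, at least on a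
  \<open>\<sigma>\<close>-algebra \<open>G\<close> for which \<open>f\<close> is measurable. The case \<open>w = 0\<close> gives orthogonality relations; the
  cases \<open>w = 1\<^sub>B\<close> and \<open>w = f\<close> give the \<open>L\<^sup>2\<close> norm of \<open>T x\<close>.\<close>

lemma has_spectral_integral_inner:
  assumes f: "has_spectral_integral M E f T"
    and G: "space G = space M" "sets G \<subseteq> sets M" "f \<in> borel_measurable G"
    and w: "w \<in> borel_measurable M" "bounded (w ` space M)"
    and eq: "\<And>C. C \<in> sets G \<Longrightarrow> inner (E C u) v = (\<integral>t. indicator C t * w t \<partial>scalar_measure M E x)"
  shows "inner (T u) v = (\<integral>t. f t * w t \<partial>scalar_measure M E x)"
proof -
  have T: "linear T"
    using f by (auto simp: has_spectral_integral_def bounded_clinear_def bounded_linear.linear)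
  have pol: "inner (S (u + v)) (u + v) - inner (S (u - v)) (u - v) = 4 * inner (S u) v"
    if "linear S" "\<And>x y. inner (S x) y = inner x (S y)" for S
    using that(2)[of v u]
    by (simp add: linear_add[OF that(1)] linear_diff[OF that(1)] inner_add inner_diff inner_commute)
  obtain K where K: "\<And>t. t \<in> space M \<Longrightarrow> \<bar>w t\<bar> \<le> K"
    using w(2) by (auto simp: bounded_iff)
  obtain L where L: "\<And>t. t \<in> space M \<Longrightarrow> \<bar>f t\<bar> \<le> L"
    using f by (auto simp: has_spectral_integral_def bounded_iff)
  let ?S = "scalar_measure M E"
  have "(\<integral>t. f t \<partial>?S (u + v)) - (\<integral>t. f t \<partial>?S (u - v)) = (\<integral>t. f t * (4 * w t) \<partial>?S x)"
  proof (rule integral_diff_eq_weighted_integral[where M = M and G = G and K = "4 * K" and L = L])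
    fix C assume C: "C \<in> sets G"
    then have CM: "C \<in> sets M"
      using G by auto
    have "measure (?S (u + v)) C - measure (?S (u - v)) C = 4 * inner (E C u) v"
      unfolding measure_pvm[OF pvm CM]
      by (intro pol bounded_linear.linear[OF pvm_linear[OF pvm CM]] pvm_inner_commute[OF pvm CM])
    also have "\<dots> = (\<integral>t. indicator C t * (4 * w t) \<partial>?S x)"
      by (simp add: eq[OF C] mult.left_commute[of _ "4::real"])
    finally show "measure (?S (u + v)) C - measure (?S (u - v)) C
      = (\<integral>t. indicator C t * (4 * w t) \<partial>?S x)" .
  qed (use G w K L in \<open>auto intro!: finite_scalar_measure[OF pvm] simp: abs_mult\<close>)
  then have "4 * inner (T u) v = 4 * (\<integral>t. f t * w t \<partial>?S x)"
    using pol[OF T has_spectral_integral_symmetric[OF f]]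
    by (simp add: has_spectral_integral_inner_self[OF f] mult.left_commute[of _ "4::real"])
  then show ?thesis by simp
qed

text \<open>The numbers \<open>\<langle>E C x, E B x\<rangle> = \<parallel>E (B \<inter> C) x\<parallel>\<^sup>2\<close> are real.\<close>

lemma pvm_inner_ii:
  assumes B: "B \<in> sets M" and C: "C \<in> sets M"
  shows "inner (E C x) (\<i> *\<^sub>C E B x) = 0"
proof -
  have sc: "E D (c *\<^sub>C y) = c *\<^sub>C E D y" if "D \<in> sets M" for D c y
    using pvm_clinear[OF pvm that] by (simp add: bounded_clinear_def)
  let ?D = "C \<inter> B"
  have D: "?D \<in> sets M" using B C by auto
  have "inner (E C x) (\<i> *\<^sub>C E B x) = inner x (\<i> *\<^sub>C E ?D x)"
    by (simp add: pvm_inner_commute[OF pvm C] sc C pvm_Int[OF pvm C B])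
  also have "\<dots> = inner (E ?D x) (\<i> *\<^sub>C E ?D x)"
    by (simp add: pvm_inner_commute[OF pvm D] sc D pvm_idem[OF pvm D])
  finally show ?thesis
    by (simp add: inner_ii_self)
qed

lemma has_spectral_integral_indicator:
  assumes B: "B \<in> sets M"
  shows "has_spectral_integral M E (indicator B) (E B)"
proof -
  have "cinner (E B x) x = complex_of_real (measure (scalar_measure M E x) B)" for x
  proof (rule complex_eqI)
    show "Im (cinner (E B x) x) = Im (complex_of_real (measure (scalar_measure M E x) B))"
      using pvm_inner_ii[OF sets.top B, of x] B by (simp add: Im_cinner pvm_space[OF pvm])
  qed (simp add: Re_cinner measure_pvm[OF pvm B])
  moreover have "bounded ((indicator B :: 'a \<Rightarrow> real) ` space M)"
    by (rule boundedI[of _ 1]) (auto simp: indicator_def)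
  ultimately show ?thesis
    using B sets.sets_into_space[OF B] pvm_clinear[OF pvm B]
    by (simp add: has_spectral_integral_def Int_absorb2)
qed

lemma has_spectral_integral_integrable:
  assumes "has_spectral_integral M E f T"
  shows "integrable (scalar_measure M E x) f"
proof -
  interpret finite_measure "scalar_measure M E x"
    by (rule finite_scalar_measure[OF pvm])
  obtain K where "\<And>t. t \<in> space M \<Longrightarrow> \<bar>f t\<bar> \<le> K"
    using assms by (auto simp: has_spectral_integral_def bounded_iff)
  then show ?thesis
    using assms by (intro integrable_const_bound[of _ K] AE_I2) (auto simp: has_spectral_integral_def)
qed

lemma has_spectral_integral_lincomb:
  assumes f: "has_spectral_integral M E f T" and g: "has_spectral_integral M E g S"
  shows "has_spectral_integral M E (\<lambda>t. a * f t + b * g t) (\<lambda>x. a *\<^sub>R T x + b *\<^sub>R S x)"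
proof -
  obtain K where K: "\<And>t. t \<in> space M \<Longrightarrow> \<bar>f t\<bar> \<le> K"
    using f by (auto simp: has_spectral_integral_def bounded_iff)
  obtain L where L: "\<And>t. t \<in> space M \<Longrightarrow> \<bar>g t\<bar> \<le> L"
    using g by (auto simp: has_spectral_integral_def bounded_iff)
  note i = has_spectral_integral_integrable[OF f] has_spectral_integral_integrable[OF g]
  have "\<bar>a * f t + b * g t\<bar> \<le> \<bar>a\<bar> * K + \<bar>b\<bar> * L" if "t \<in> space M" for t
    by (rule order_trans[OF abs_triangle_ineq])
      (use K[OF that] L[OF that] in \<open>auto simp: abs_mult intro!: add_mono mult_left_mono\<close>)
  then have "bounded ((\<lambda>t. a * f t + b * g t) ` space M)"
    by (auto simp: bounded_iff)
  moreover have "bounded_clinear (\<lambda>x. a *\<^sub>R T x + b *\<^sub>R S x)"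
  proof -
    have r: "c *\<^sub>C r *\<^sub>R x = r *\<^sub>R c *\<^sub>C x" for c r and x :: 'h
      by (simp add: scaleC_of_real[symmetric] scaleC_scaleC mult.commute)
    show ?thesis
      using f g by (auto simp: has_spectral_integral_def bounded_clinear_def scaleC_add_right r
          intro!: bounded_linear_add bounded_linear_const_scaleR)
  qed
  moreover have "cinner (a *\<^sub>R T x + b *\<^sub>R S x) x = a * cinner (T x) x + b * cinner (S x) x" for x
    by (simp add: cinner_add_left cinner_scaleC_left flip: scaleC_of_real)
  ultimately show ?thesis
    using f g i by (simp add: has_spectral_integral_def)
qed

lemma has_spectral_integral_inner_projection:
  assumes f: "has_spectral_integral M E f T" and B: "B \<in> sets M"
  shows "inner (T x) (E B x) = (\<integral>t. f t * indicator B t \<partial>scalar_measure M E x)"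
proof (rule has_spectral_integral_inner[OF f, where G = M])
  show "inner (E C x) (E B x) = (\<integral>t. indicator C t * indicator B t \<partial>scalar_measure M E x)"
    if C: "C \<in> sets M" for C
  proof -
    have "inner (E C x) (E B x) = inner (E (B \<inter> C) x) x"
      by (metis B C pvm pvm_Int pvm_inner_commute inner_commute)
    also have "\<dots> = (\<integral>t. indicator (B \<inter> C) t \<partial>scalar_measure M E x)"
      using B C sets.sets_into_space[OF B] by (simp add: measure_pvm[OF pvm] Int_absorb2 inf.coboundedI1)
    also have "(indicator (B \<inter> C) :: 'a \<Rightarrow> real) = (\<lambda>t. indicator C t * indicator B t)"
      by (auto simp: indicator_def)
    finally show ?thesis .
  qed
qed (use f B in \<open>auto simp: has_spectral_integral_def bounded_iff indicator_def intro!: exI[of _ 1]\<close>)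

text \<open>Applying the bilinear formula twice replaces the multiplicativity of the functional calculus:
  first \<open>\<langle>E x, T x\<rangle>\<close> is found to have density \<open>f\<close>, then \<open>T\<close> is integrated against it.\<close>

lemma has_spectral_integral_norm:
  assumes f: "has_spectral_integral M E f T"
  shows "(norm (T x))\<^sup>2 = (\<integral>t. (f t)\<^sup>2 \<partial>scalar_measure M E x)"
proof -
  have "inner (T x) (T x) = (\<integral>t. f t * f t \<partial>scalar_measure M E x)"
  proof (rule has_spectral_integral_inner[OF f, where G = M])
    show "inner (E C x) (T x) = (\<integral>t. indicator C t * f t \<partial>scalar_measure M E x)"
      if "C \<in> sets M" for C
      using has_spectral_integral_inner_projection[OF f that, of x]
      by (simp add: inner_commute mult.commute)
  qed (use f in \<open>auto simp: has_spectral_integral_def\<close>)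
  then show ?thesis
    unfolding power2_norm_eq_inner by (simp add: power2_eq_square)
qed

lemma has_spectral_integral_inner_ii:
  assumes f: "has_spectral_integral M E f T" and B: "B \<in> sets M"
  shows "inner (T x) (\<i> *\<^sub>C E B x) = 0"
  using has_spectral_integral_inner[OF f, of M "\<lambda>_. 0" x "\<i> *\<^sub>C E B x" x] f pvm_inner_ii[OF B]
  by (auto simp: has_spectral_integral_def image_constant_conv)

text \<open>If \<open>y\<close> is orthogonal to all \<open>E(B)x\<close> with \<open>B\<close> in \<open>G\<close>, then \<open>C \<mapsto> \<langle>E(C)y, E(B)x\<rangle> = \<langle>y, E(C \<inter> B)x\<rangle>\<close>
  vanishes on \<open>G\<close>, and so does the integral of a \<open>G\<close>-measurable function against it. The scalar \<open>c\<close>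
  in the proof takes the values \<open>1\<close> and \<open>\<i>\<close> to reach both parts of the complex inner product.\<close>

lemma has_spectral_integral_cperp:
  assumes f: "has_spectral_integral M E f T"
    and G: "space G = space M" "sets G \<subseteq> sets M" "f \<in> borel_measurable G"
    and y: "y \<in> cperp ((\<lambda>B. E B x) ` sets G)"
  shows "T y \<in> cperp ((\<lambda>B. E B x) ` sets G)"
proof -
  have "inner (T y) (c *\<^sub>C E B x) = 0" if B: "B \<in> sets G" for B c
  proof -
    have "inner (E C y) (c *\<^sub>C E B x) = 0" if C: "C \<in> sets G" for C
    proof -
      have BM: "B \<in> sets M" and CM: "C \<in> sets M"
        using B C G by auto
      have "inner (E C y) (c *\<^sub>C E B x) = inner y (c *\<^sub>C E (C \<inter> B) x)"
        using pvm_clinear[OF pvm CM]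
        by (simp add: pvm_inner_commute[OF pvm CM] pvm_Int[OF pvm CM BM] bounded_clinear_def)
      also have "\<dots> = 0"
        using y B C by (auto simp: cperp_def cinner_scaleC_right simp flip: Re_cinner)
      finally show ?thesis .
    qed
    then show ?thesis
      using has_spectral_integral_inner[OF f G, of "\<lambda>_. 0" y "c *\<^sub>C E B x" x]
      by (auto simp: image_constant_conv)
  qed
  from this[where c = 1] this[where c = \<i>] show ?thesis
    using scaleC_of_real[of 1, where ?'a = 'h] by (auto simp: cperp_def cinner_eq_0_iff)
qed

end

section \<open>Separating vectors\<close>

text \<open>Exhaustion: the union of a sequence whose measures approach the supremum attains it.\<close>

lemma exists_essentially_largest_set:
  assumes "finite_measure P" and sub: "\<N> \<subseteq> sets P" and ne: "\<N> \<noteq> {}"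
    and Un: "\<And>B :: nat \<Rightarrow> 'a set. range B \<subseteq> \<N> \<Longrightarrow> (\<Union>n. B n) \<in> \<N>"
  shows "\<exists>N\<in>\<N>. \<forall>B\<in>\<N>. B - N \<in> null_sets P"
proof -
  interpret finite_measure P by fact
  define s where "s = Sup (measure P ` \<N>)"
  have bdd: "bdd_above (measure P ` \<N>)"
    by (auto intro!: bdd_aboveI[of _ "measure P (space P)"] bounded_measure)
  have le_s: "measure P B \<le> s" if "B \<in> \<N>" for B
    unfolding s_def using that bdd by (intro cSup_upper) auto
  have "\<exists>B\<in>\<N>. s - 1 / Suc n < measure P B" for n :: nat
    using less_cSup_iff[of "measure P ` \<N>" "s - 1 / Suc n"] ne bdd by (auto simp: s_def)
  then obtain B where B: "B n \<in> \<N>" "s - 1 / Suc n < measure P (B n)" for n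
    by metis
  define N where "N = (\<Union>n. B n)"
  have N: "N \<in> \<N>"
    unfolding N_def using B by (intro Un) auto
  have "s - 1 / Suc n \<le> measure P N" for n
  proof -
    have "measure P (B n) \<le> measure P N"
      using N sub by (intro finite_measure_mono) (auto simp: N_def)
    then show ?thesis using B(2)[of n] by simp
  qed
  then have s_le: "s \<le> measure P N"
    using tendsto_diff[OF tendsto_const LIMSEQ_inverse_real_of_nat, of s]
    by (intro LIMSEQ_le_const2[of "\<lambda>n. s - 1 / real (Suc n)"]) (auto simp: inverse_eq_divide)
  have "C - N \<in> null_sets P" if C: "C \<in> \<N>" for C
  proof -
    have "(\<Union>n. case n of 0 \<Rightarrow> C | Suc _ \<Rightarrow> N) \<in> \<N>"
      using C N by (intro Un) (auto split: nat.splits)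
    also have "(\<Union>n. case n of 0 \<Rightarrow> C | Suc _ \<Rightarrow> N) = N \<union> C"
      by (auto split: nat.splits intro: exI[of _ 0])
    finally have "measure P (N \<union> C) \<le> measure P N"
      using le_s s_le by force
    moreover have "measure P (N \<union> C) = measure P N + measure P (C - N)"
      using sub C N by (intro finite_measure_Union') auto
    ultimately have "measure P (C - N) = 0"
      by (simp add: antisym)
    then show ?thesis
      using sub C N by (intro null_setsI) (auto simp: emeasure_eq_measure)
  qed
  then show ?thesis
    using N by blast
qed

text \<open>The series that defines a separating vector is summed by the comparison test, which is stated
  for Banach spaces.\<close>

instance complex_hilbert \<subseteq> banach ..

text \<open>Let \<open>\<psi>\<^sub>n\<close> be a dense sequence. Among the sets that are null for all \<open>\<psi>\<^sub>m\<close> with \<open>m < n\<close>, let \<open>N\<^sub>n\<close> be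
  essentially largest for \<open>\<psi>\<^sub>n\<close>: it carries the part of \<open>\<psi>\<^sub>n\<close> that the earlier vectors do not
  see. The sets \<open>D\<^sub>n\<close> obtained from \<open>N\<^sub>n\<close> by removing all later \<open>N\<^sub>k\<close> are disjoint, and nothing is
  lost because \<open>N\<^sub>k\<close> is null for \<open>\<psi>\<^sub>n\<close> when \<open>k > n\<close>. So the components of the weighted sum
  \<open>\<omega> = \<Sum> c\<^sub>n E(D\<^sub>n)\<psi>\<^sub>n\<close> can be read off, and if \<open>B\<close> is null for \<open>\<omega>\<close>, then \<open>B \<inter> N\<^sub>n\<close> is null for
  \<open>\<psi>\<^sub>n\<close>. By induction \<open>B\<close> is null for every \<open>\<psi>\<^sub>n\<close>: once it is null for the earlier vectors, the
  choice of \<open>N\<^sub>n\<close> makes \<open>B - N\<^sub>n\<close> null for \<open>\<psi>\<^sub>n\<close>.\<close>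

lemma exists_separating_vector:
  fixes E :: "'a set \<Rightarrow> 'h::complex_hilbert \<Rightarrow> 'h"
  assumes pvm: "pvm M E" and sep: "separable_space (euclidean :: 'h topology)"
  shows "\<exists>\<omega>. \<forall>B\<in>sets M. E B \<omega> = 0 \<longrightarrow> (\<forall>x. E B x = 0)"
proof -
  have lin: "bounded_linear (E B)" if "B \<in> sets M" for B
    by (rule pvm_linear[OF pvm that])
  obtain C :: "'h set" where C: "countable C" "closure C = UNIV"
    using sep by (auto simp: separable_space_def)
  then have "C \<noteq> {}" by auto
  define \<psi> where "\<psi> = from_nat_into C"
  have \<psi>: "range \<psi> = C"
    unfolding \<psi>_def by (rule range_from_nat_into) fact+
  define \<N> where "\<N> n = {B\<in>sets M. \<forall>m<n. E B (\<psi> m) = 0}" for n :: nat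
  have UN_null: "E (\<Union>n. B n) x = 0" if "range B \<subseteq> sets M" "\<And>n. E (B n) x = 0" for B :: "nat \<Rightarrow> 'a set" and x
    using that null_sets_UN[of B "scalar_measure M E x"] 
    by (subst pvm_null_iff[OF pvm, symmetric]) (auto simp: pvm_null_iff[OF pvm] range_subsetD)
  have "\<exists>N\<in>\<N> n. \<forall>B\<in>\<N> n. B - N \<in> null_sets (scalar_measure M E (\<psi> n))" for n
  proof (rule exists_essentially_largest_set[OF finite_scalar_measure[OF pvm]])
    show "\<N> n \<noteq> {}"
    proof -
      have "E {} x = 0" for x
        using povm_empty_inner[OF pvm_povm[OF pvm], of x "E {} x"] by simp
      then have "{} \<in> \<N> n"
        by (simp add: \<N>_def)
      then show ?thesis by blast
    qed
    show "(\<Union>k. B k) \<in> \<N> n" if "range B \<subseteq> \<N> n" for B :: "nat \<Rightarrow> 'a set"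
    proof -
      have "B k \<in> sets M" "m < n \<Longrightarrow> E (B k) (\<psi> m) = 0" for k m
        using that by (auto simp: \<N>_def)
      then show ?thesis
        using UN_null[of B] by (auto simp: \<N>_def image_subset_iff)
    qed
  qed (auto simp: \<N>_def)
  then obtain N where N: "N n \<in> \<N> n" and
    N_max: "\<And>B. B \<in> \<N> n \<Longrightarrow> B - N n \<in> null_sets (scalar_measure M E (\<psi> n))" for n
    by metis
  have NM [measurable]: "N n \<in> sets M" and N0: "m < n \<Longrightarrow> E (N n) (\<psi> m) = 0" for m n
    using N[of n] by (auto simp: \<N>_def)
  define D where "D n = N n - (\<Union>k. N (n + Suc k))" for n
  have DM [measurable]: "D n \<in> sets M" for n
    unfolding D_def by measurable
  have D_disj: "D m \<inter> D n = {}" if "m \<noteq> n" for m n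
    using that
  proof (induction m n rule: linorder_wlog)
    case (le m n)
    then have "n = m + Suc (n - m - 1)" by simp
    then have "N n \<subseteq> (\<Union>k. N (m + Suc k))" by (metis UN_upper UNIV_I)
    then show ?case by (auto simp: D_def)
  qed (simp add: Int_commute)
  have ED: "E (D n) (\<psi> n) = E (N n) (\<psi> n)" for n
  proof -
    let ?U = "N n \<inter> (\<Union>k. N (n + Suc k))"
    have "E (\<Union>k. N (n + Suc k)) (\<psi> n) = 0"
      by (rule UN_null) (auto simp: N0)
    then have "E ?U (\<psi> n) = 0"
      by (intro pvm_mono_null[OF pvm, of "\<Union>k. N (n + Suc k)" ?U]) auto
    moreover have "E (D n \<union> ?U) (\<psi> n) = E (D n) (\<psi> n) + E ?U (\<psi> n)"
      by (intro pvm_union_disjoint[OF pvm]) (auto simp: D_def)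
    moreover have "D n \<union> ?U = N n"
      by (auto simp: D_def)
    ultimately show ?thesis by simp
  qed
  define c where "c n = (1/2) ^ n / (1 + norm (\<psi> n))" for n
  have c: "c n > 0" for n
    by (simp add: c_def add_pos_nonneg)
  have "norm (c n *\<^sub>R E (D n) (\<psi> n)) \<le> (1/2) ^ n" for n
  proof -
    have "norm (c n *\<^sub>R E (D n) (\<psi> n)) \<le> c n * (1 + norm (\<psi> n))"
      using c[of n] pvm_norm_le[OF pvm DM, of n "\<psi> n"] by (simp add: mult_left_mono)
    also have "\<dots> = (1/2) ^ n"
      using norm_ge_zero[of "\<psi> n"] by (simp add: c_def add_nonneg_eq_0_iff)
    finally show ?thesis .
  qed
  then have "summable (\<lambda>n. c n *\<^sub>R E (D n) (\<psi> n))"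
    by (intro summable_comparison_test[OF _ summable_geometric[of "1/2::real"]]) auto
  then obtain \<omega> where \<omega>: "(\<lambda>n. c n *\<^sub>R E (D n) (\<psi> n)) sums \<omega>"
    by (auto simp: summable_def)
  have D\<omega>: "E (D n) \<omega> = c n *\<^sub>R E (D n) (\<psi> n)" for n
  proof -
    interpret bounded_linear "E (D n)" by (rule lin) simp
    have "(\<lambda>m. E (D n) (c m *\<^sub>R E (D m) (\<psi> m))) sums E (D n) \<omega>"
      by (rule sums) (rule \<omega>)
    moreover have "E (D n) (c m *\<^sub>R E (D m) (\<psi> m)) = (if m = n then c n *\<^sub>R E (D n) (\<psi> n) else 0)" for m
      using pvm_disjoint[OF pvm DM DM D_disj, of n m] pvm_idem[OF pvm DM] by (auto simp: scaleR)
    ultimately show ?thesis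
      using sums_single[of n "\<lambda>_. c n *\<^sub>R E (D n) (\<psi> n)"] by (auto dest: sums_unique2)
  qed
  have "E B x = 0" if B: "B \<in> sets M" and B0: "E B \<omega> = 0" for B x
  proof -
    have *: "E (B \<inter> N n) (\<psi> n) = 0" for n
    proof -
      interpret EB: bounded_linear "E B" by (rule lin[OF B])
      interpret ED: bounded_linear "E (D n)" by (rule lin) simp
      have "c n *\<^sub>R E B (E (D n) (\<psi> n)) = E B (E (D n) \<omega>)"
        by (simp add: D\<omega> EB.scaleR)
      also have "\<dots> = E (D n) (E B \<omega>)"
        by (simp add: pvm_Int[OF pvm] B Int_commute)
      also have "\<dots> = 0"
        by (simp add: B0 ED.zero)
      finally have "E B (E (N n) (\<psi> n)) = 0"
        using c[of n] by (simp add: ED)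
      then show ?thesis
        by (simp add: pvm_Int[OF pvm] B)
    qed
    have "E B (\<psi> n) = 0" for n
    proof (induction n rule: less_induct)
      case (less n)
      then have "B \<in> \<N> n"
        using B by (simp add: \<N>_def)
      then have "E (B - N n) (\<psi> n) = 0"
        using N_max[of B n] B by (simp add: pvm_null_iff[OF pvm])
      moreover have "E ((B \<inter> N n) \<union> (B - N n)) (\<psi> n) = E (B \<inter> N n) (\<psi> n) + E (B - N n) (\<psi> n)"
        by (rule pvm_union_disjoint[OF pvm]) (use B in auto)
      ultimately show ?case
        using * by (simp add: Int_Diff_Un)
    qed
    then have "C \<subseteq> {x. E B x = 0}"
      using \<psi> by auto
    moreover have "closed {x. E B x = 0}"
      by (intro closed_Collect_eq continuous_intros bounded_linear.continuous_on[OF lin[OF B]])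
    ultimately have "closure C \<subseteq> {x. E B x = 0}"
      by (rule closure_minimal)
    then show ?thesis
      using C by auto
  qed
  then show ?thesis by blast
qed

section \<open>Separation of points\<close>

text \<open>The functions are the real linear combinations of indicators of sets in \<open>G\<close>.\<close>

lemma span_projections_spectral_integral:
  fixes E :: "'a set \<Rightarrow> 'h::complex_hilbert \<Rightarrow> 'h"
  assumes pvm: "pvm M E" and G: "space G = space M" "sets G \<subseteq> sets M"
    and p: "p \<in> span ((\<lambda>B. E B x) ` sets G)"
  shows "\<exists>s S. has_spectral_integral M E s S \<and> s \<in> borel_measurable G \<and> p = S x"
  using p
proof (induction rule: span_induct_alt)
  case base
  have "has_spectral_integral M E (\<lambda>t. 0 * indicator {} t + 0 * indicator {} t)
      (\<lambda>x. 0 *\<^sub>R E {} x + 0 *\<^sub>R E {} x)"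
    by (intro has_spectral_integral_lincomb[OF pvm] has_spectral_integral_indicator[OF pvm]) auto
  then have "has_spectral_integral M E (\<lambda>_. 0) (\<lambda>_. 0)"
    by simp
  then show ?case
    using borel_measurable_const by blast
next
  case (step c b p)
  then obtain B s S where B: "B \<in> sets G" "b = E B x"
    and S: "has_spectral_integral M E s S" "s \<in> borel_measurable G" "p = S x"
    by blast
  have "has_spectral_integral M E (\<lambda>t. c * indicator B t + 1 * s t) (\<lambda>x. c *\<^sub>R E B x + 1 *\<^sub>R S x)"
    using B G by (intro has_spectral_integral_lincomb[OF pvm] has_spectral_integral_indicator[OF pvm] S) auto
  moreover have "(\<lambda>t. c * indicator B t + 1 * s t) \<in> borel_measurable G"
    using B S by simp
  ultimately show ?case
    using B S by (intro exI[of _ "\<lambda>t. c * indicator B t + 1 * s t"] exI[of _ "\<lambda>x. c *\<^sub>R E B x + 1 *\<^sub>R S x"]) auto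
qed

lemma subspace_closure:
  fixes S :: "'h::real_normed_vector set"
  assumes S: "subspace S"
  shows "subspace (closure S)"
proof (intro subspaceI)
  show "0 \<in> closure S"
    using subspace_0[OF S] closure_subset by blast
  fix x y assume "x \<in> closure S" "y \<in> closure S"
  then obtain u v where "\<And>n. u n \<in> S" "u \<longlonglongrightarrow> x" "\<And>n. v n \<in> S" "v \<longlonglongrightarrow> y"
    by (auto simp: closure_sequential)
  then show "x + y \<in> closure S"
    by (intro closure_sequential[THEN iffD2] exI[of _ "\<lambda>n. u n + v n"])
      (auto intro: subspace_add[OF S] tendsto_add)
next
  fix c :: real and x assume "x \<in> closure S"
  then obtain u where "\<And>n. u n \<in> S" "u \<longlonglongrightarrow> x"
    by (auto simp: closure_sequential)
  then show "c *\<^sub>R x \<in> closure S"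
    by (intro closure_sequential[THEN iffD2] exI[of _ "\<lambda>n. c *\<^sub>R u n"])
      (auto intro: subspace_scale[OF S] tendsto_scaleR)
qed

text \<open>The biorthogonal complement is a complex notion, whereas the span here is the real one, so that
  its elements are integrals of real functions. The two match because \<open>T x\<close> and the vectors
  \<open>E(B)x\<close> have real inner products with each other: the residual of the real orthogonal projection
  is therefore also complex orthogonal to them.\<close>

lemma in_closure_span_projections:
  fixes E :: "'a set \<Rightarrow> 'h::complex_hilbert \<Rightarrow> 'h"
  assumes pvm: "pvm M E" and G: "space G = space M" "sets G \<subseteq> sets M"
    and T: "has_spectral_integral M E f T"
    and perp: "T x \<in> cperp (cperp ((\<lambda>B. E B x) ` sets G))"
  shows "T x \<in> closure (span ((\<lambda>B. E B x) ` sets G))"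
proof -
  let ?L = "(\<lambda>B. E B x) ` sets G"
  let ?K = "closure (span ?L)"
  have "subspace ?K"
    by (intro subspace_closure) simp
  then obtain p where p: "p \<in> ?K" "\<And>b. b \<in> ?K \<Longrightarrow> inner (T x - p) b = 0"
    using orthogonal_projection_exists[of ?K "T x"] by auto
  have "cinner (T x - p) b = 0" if b: "b \<in> ?L" for b
  proof -
    obtain B where B: "B \<in> sets G" "b = E B x" using b by auto
    then have BM: "B \<in> sets M" using G by auto
    have "?K \<subseteq> {z. inner z (\<i> *\<^sub>C b) = 0}"
    proof (rule closure_minimal)
      show "span ?L \<subseteq> {z. inner z (\<i> *\<^sub>C b) = 0}"
      proof (rule span_minimal)
        show "?L \<subseteq> {z. inner z (\<i> *\<^sub>C b) = 0}"
          using G by (auto simp: B intro!: pvm_inner_ii[OF pvm BM])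
        show "subspace {z. inner z (\<i> *\<^sub>C b) = 0}"
          by (auto simp: subspace_def inner_add_left)
      qed
      show "closed {z. inner z (\<i> *\<^sub>C b) = 0}"
        by (intro closed_Collect_eq continuous_intros)
    qed
    from subsetD[OF this p(1)] have "inner p (\<i> *\<^sub>C b) = 0"
      by simp
    moreover have "inner (T x) (\<i> *\<^sub>C b) = 0"
      using has_spectral_integral_inner_ii[OF pvm T BM] B by simp
    moreover have "b \<in> ?K"
      by (rule subsetD[OF closure_subset span_base[OF b]])
    ultimately show ?thesis
      using p(2)[of b] by (simp add: cinner_eq_0_iff inner_diff_left)
  qed
  then have "T x - p \<in> cperp ?L"
    by (simp add: cperp_def)
  then have "cinner (T x) (T x - p) = 0"
    using perp by (simp add: cperp_def[of "cperp ?L"])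
  then have "inner (T x) (T x - p) = 0"
    by (simp add: cinner_eq_0_iff)
  moreover have "inner p (T x - p) = 0"
    using p(2)[OF p(1)] by (subst inner_commute)
  ultimately have "inner (T x - p) (T x - p) = 0"
    by (subst inner_diff_left) simp
  then have "T x = p"
    by simp
  then show ?thesis
    using p(1) by (rule ssubst)
qed

text \<open>The map \<open>s \<mapsto> s(A)x\<close> is isometric for the \<open>L\<^sup>2\<close> norm of \<open>\<langle>E x, x\<rangle>\<close>, so approximating \<open>T x\<close> in norm
  means approximating \<open>f\<close> in mean square.\<close>

lemma AE_limit_of_measurable:
  fixes E :: "'a set \<Rightarrow> 'h::complex_hilbert \<Rightarrow> 'h"
  assumes pvm: "pvm M E" and G: "space G = space M" "sets G \<subseteq> sets M"
    and T: "has_spectral_integral M E f T"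
    and cl: "T x \<in> closure (span ((\<lambda>B. E B x) ` sets G))"
  shows "\<exists>s :: nat \<Rightarrow> 'a \<Rightarrow> real. (\<forall>n. s n \<in> borel_measurable G)
           \<and> (AE t in scalar_measure M E x. (\<lambda>n. s n t) \<longlonglongrightarrow> f t)"
proof -
  obtain p where p: "p n \<in> span ((\<lambda>B. E B x) ` sets G)" "p \<longlonglongrightarrow> T x" for n :: nat
    using cl by (auto simp: closure_sequential)
  have "\<forall>n. \<exists>s S. has_spectral_integral M E s S \<and> s \<in> borel_measurable G \<and> p n = S x"
    using span_projections_spectral_integral[OF pvm G p(1)] by blast
  then obtain s S where S: "\<And>n. has_spectral_integral M E (s n) (S n)"
    "\<And>n. s n \<in> borel_measurable G" "\<And>n. p n = S n x"
    by metis
  let ?P = "scalar_measure M E x"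
  have D: "has_spectral_integral M E (\<lambda>t. 1 * f t + (- 1) * s n t) (\<lambda>x. 1 *\<^sub>R T x + (- 1) *\<^sub>R S n x)" for n
    by (intro has_spectral_integral_lincomb[OF pvm] T S)
  interpret finite_measure ?P
    by (rule finite_scalar_measure[OF pvm])
  have norm_eq: "(norm (T x - p n))\<^sup>2 = (\<integral>t. (f t - s n t)\<^sup>2 \<partial>?P)" for n
    using has_spectral_integral_norm[OF pvm D, of x n] by (simp add: S)
  have int: "integrable ?P (\<lambda>t. (f t - s n t)\<^sup>2)" for n
  proof -
    obtain K where K: "\<And>t. t \<in> space M \<Longrightarrow> \<bar>f t - s n t\<bar> \<le> K"
      using D[of n] by (auto simp: has_spectral_integral_def bounded_iff)
    have "(\<lambda>t. (f t - s n t)\<^sup>2) \<in> borel_measurable M"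
      using T S(1)[of n] by (auto simp: has_spectral_integral_def)
    moreover have "norm ((f t - s n t)\<^sup>2) \<le> K\<^sup>2" if "t \<in> space M" for t
      using power_mono[OF K[OF that] abs_ge_zero, of 2] by simp
    ultimately show ?thesis
      by (intro integrable_const_bound[of _ "K\<^sup>2"] AE_I2) simp_all
  qed
  have "(\<lambda>n. (norm (T x - p n))\<^sup>2) \<longlonglongrightarrow> (norm (T x - T x))\<^sup>2"
    by (intro tendsto_intros p)
  then have "(\<lambda>n. \<integral>t. norm ((f t - s n t)\<^sup>2) \<partial>?P) \<longlonglongrightarrow> 0"
    by (simp add: norm_eq)
  from tendsto_L1_AE_subseq[OF int this]
  obtain r :: "nat \<Rightarrow> nat" where ae: "AE t in ?P. (\<lambda>n. (f t - s (r n) t)\<^sup>2) \<longlonglongrightarrow> 0"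
    by blast
  have "(\<lambda>n. s (r n) t) \<longlonglongrightarrow> f t" if "(\<lambda>n. (f t - s (r n) t)\<^sup>2) \<longlonglongrightarrow> 0" for t
  proof -
    have "(\<lambda>n. f t - s (r n) t) \<longlonglongrightarrow> 0"
      using tendsto_real_sqrt[OF that] by (simp add: tendsto_rabs_zero_iff)
    from tendsto_diff[OF tendsto_const[of "f t"] this] show ?thesis
      by simp
  qed
  then have "AE t in ?P. (\<lambda>n. s (r n) t) \<longlonglongrightarrow> f t"
    by (rule eventually_mono[OF ae])
  then show ?thesis
    using S(2) by (intro exI[of _ "\<lambda>n. s (r n)"]) auto
qed

text \<open>The sets that do not separate \<open>a\<close> from \<open>b\<close> form a \<open>\<sigma>\<close>-algebra.\<close>

lemma sigma_measurable_inseparable: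
  fixes u :: "'a \<Rightarrow> real"
  assumes u: "u \<in> borel_measurable (sigma \<Omega> \<C>)" and \<C>: "\<C> \<subseteq> Pow \<Omega>"
    and same: "\<And>B. B \<in> \<C> \<Longrightarrow> a \<in> B \<longleftrightarrow> b \<in> B" and ab: "a \<in> \<Omega>" "b \<in> \<Omega>"
  shows "u a = u b"
proof -
  have *: "a \<in> B \<longleftrightarrow> b \<in> B" if "B \<in> sigma_sets \<Omega> \<C>" for B
    using that by induction (use same ab in auto)
  have "u -` {u a} \<inter> space (sigma \<Omega> \<C>) \<in> sets (sigma \<Omega> \<C>)"
    using u by (rule measurable_sets) simp
  then have "u -` {u a} \<inter> \<Omega> \<in> sigma_sets \<Omega> \<C>"
    using \<C> by (simp add: space_measure_of_conv)
  from *[OF this] show ?thesis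
    using ab by auto
qed

theorem theorem3p1:
  fixes F :: "'x::{t2_space, second_countable_topology} set \<Rightarrow> 'h::complex_hilbert \<Rightarrow> 'h"
    and A :: "'h \<Rightarrow> 'h"
    and E :: "real set \<Rightarrow> 'h \<Rightarrow> 'h"
    and \<mu> :: "'x set \<Rightarrow> real \<Rightarrow> real"
  assumes "locally_compact_space (euclidean :: 'x topology)"
    and "separable_space (euclidean :: 'h topology)"
    and "povm borel F"
    and "bounded_selfadjoint A"
    and "is_spectral_measure A E"
    and "weak_markov_kernel_pvm (spectrum_borel A) E borel \<mu>"
    and "von_neumann_triplet E F A \<mu>"
    and "sharp_version A F"
  shows "\<exists>\<Gamma>. \<Gamma> \<subseteq> real_spectrum A \<and> \<Gamma> \<in> sets (spectrum_borel A) \<and> E \<Gamma> = id \<and>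
           (\<forall>s\<in>\<Gamma>. \<forall>t\<in>\<Gamma>. s \<noteq> t \<longrightarrow> (\<exists>\<Delta>\<in>sets (borel :: 'x measure). \<mu> \<Delta> s \<noteq> \<mu> \<Delta> t))"
proof -
  define M where "M = spectrum_borel A"
  have spM: "space M = real_spectrum A"
    by (simp add: M_def spectrum_borel_def space_restrict_space)
  have pvm: "pvm M E" and A: "has_spectral_integral M E (\<lambda>t. t) A"
    using assms(5) by (auto simp: is_spectral_measure_def M_def)
  have F: "has_spectral_integral M E (\<mu> \<Delta>) (F \<Delta>)" if "\<Delta> \<in> sets borel" for \<Delta>
    using assms(7) that by (auto simp: von_neumann_triplet_def M_def)
  then have \<mu>: "\<mu> \<Delta> \<in> borel_measurable M" if "\<Delta> \<in> sets borel" for \<Delta>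
    using that by (auto simp: has_spectral_integral_def)
  obtain \<omega> where \<omega>: "\<And>B x. B \<in> sets M \<Longrightarrow> E B \<omega> = 0 \<Longrightarrow> E B x = 0"
    using exists_separating_vector[OF pvm assms(2)] by blast
  define \<C> where "\<C> = {\<mu> \<Delta> -` U \<inter> space M |\<Delta> U. \<Delta> \<in> sets borel \<and> U \<in> sets borel}"
  define G where "G = sigma (space M) \<C>"
  have \<C>: "\<C> \<subseteq> Pow (space M)" "\<C> \<subseteq> sets M"
    using \<mu> by (auto simp: \<C>_def measurable_sets)
  have G: "space G = space M" "sets G \<subseteq> sets M"
    using \<C> sets.sigma_sets_subset[OF \<C>(2)] by (auto simp: G_def space_measure_of_conv)
  have \<mu>G: "\<mu> \<Delta> \<in> borel_measurable G" if "\<Delta> \<in> sets borel" for \<Delta>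
    using that \<C> unfolding measurable_def G(1)
    by (auto simp: G_def \<C>_def intro!: sigma_sets.Basic)
  define L where "L = (\<lambda>B. E B \<omega>) ` sets G"
  define N where "N = {T. bounded_clinear T \<and> T ` cperp L \<subseteq> cperp L
                          \<and> T ` cperp (cperp L) \<subseteq> cperp (cperp L)}"
  have N: "von_neumann_algebra N"
    unfolding N_def by (rule cperp_reducing_von_neumann_algebra)
  have "F \<Delta> \<in> N" if \<Delta>: "\<Delta> \<in> sets borel" for \<Delta>
  proof -
    have L: "F \<Delta> y \<in> cperp L" if "y \<in> cperp L" for y
      using has_spectral_integral_cperp[OF pvm F[OF \<Delta>] G \<mu>G[OF \<Delta>]] that by (simp add: L_def)
    have "is_adjoint (F \<Delta>) (F \<Delta>)"
      using assms(3) \<Delta> by (auto simp: povm_def bounded_positive_def bounded_selfadjoint_def)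
    then have "cinner (F \<Delta> x) y = cinner x (F \<Delta> y)" for x y
      by (simp add: is_adjoint_def)
    then have "F \<Delta> x \<in> cperp (cperp L)" if "x \<in> cperp (cperp L)" for x
      using that L by (simp add: cperp_def[of "cperp L"])
    then show ?thesis
      using L F[OF \<Delta>] by (auto simp: N_def has_spectral_integral_def)
  qed
  then have "generated_von_neumann_algebra (F ` sets borel) \<subseteq> N"
    using N by (auto simp: generated_von_neumann_algebra_def)
  moreover have "A \<in> generated_von_neumann_algebra {A}"
    by (auto simp: generated_von_neumann_algebra_def)
  ultimately have "A \<in> N"
    using assms(8) by (auto simp: sharp_version_def)
  moreover have "\<omega> \<in> cperp (cperp L)"
  proof -
    have "\<omega> \<in> L"
      unfolding L_def using sets.top[of G] pvm_space[OF pvm, of \<omega>] G(1) by force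
    then show ?thesis
      by (simp add: cperp_def) (metis cinner_eq_0_commute)
  qed
  ultimately have "A \<omega> \<in> cperp (cperp L)"
    by (auto simp: N_def)
  then have "A \<omega> \<in> closure (span L)"
    unfolding L_def by (rule in_closure_span_projections[OF pvm G A])
  from AE_limit_of_measurable[OF pvm G A this[unfolded L_def]]
  obtain s :: "nat \<Rightarrow> real \<Rightarrow> real" where s_ae: "(\<forall>n. s n \<in> borel_measurable G)
      \<and> (AE t in scalar_measure M E \<omega>. (\<lambda>n. s n t) \<longlonglongrightarrow> t)" ..
  then have s: "s n \<in> borel_measurable G" for n
    by simp
  obtain Z where Z: "\<And>t. t \<in> space M - Z \<Longrightarrow> (\<lambda>n. s n t) \<longlonglongrightarrow> t"
      "Z \<in> null_sets (scalar_measure M E \<omega>)"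
    by (rule AE_E3[OF conjunct2[OF s_ae], unfolded space_scalar_measure]) (rule that)
  have ZM: "Z \<in> sets M"
    using Z(2) by (auto dest: null_setsD2)
  define \<Gamma> where "\<Gamma> = space M - Z"
  have \<Gamma>: "\<Gamma> \<in> sets M"
    using ZM by (auto simp: \<Gamma>_def)
  have conv: "(\<lambda>n. s n t) \<longlonglongrightarrow> t" if "t \<in> \<Gamma>" for t
    using Z(1) that by (auto simp: \<Gamma>_def)
  have "E Z \<omega> = 0"
    using Z(2) ZM by (simp add: pvm_null_iff[OF pvm])
  then have EZ: "E Z x = 0" for x
    by (rule \<omega>[OF ZM])
  have "Z \<union> \<Gamma> = space M"
    using sets.sets_into_space[OF ZM] by (auto simp: \<Gamma>_def)
  have "E \<Gamma> x = x" for x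
  proof -
    have "E \<Gamma> x = E Z x + E \<Gamma> x"
      by (simp add: EZ)
    also have "\<dots> = E (Z \<union> \<Gamma>) x"
      by (rule pvm_union_disjoint[OF pvm ZM \<Gamma>, symmetric]) (auto simp: \<Gamma>_def)
    also have "\<dots> = x"
      by (simp only: \<open>Z \<union> \<Gamma> = space M\<close> pvm_space[OF pvm])
    finally show ?thesis .
  qed
  then have "E \<Gamma> = id"
    by (simp add: fun_eq_iff)
  moreover have "\<exists>\<Delta>\<in>sets borel. \<mu> \<Delta> a \<noteq> \<mu> \<Delta> b" if a: "a \<in> \<Gamma>" and b: "b \<in> \<Gamma>" and "a \<noteq> b" for a b
  proof (rule ccontr)
    assume "\<not> ?thesis"
    then have same: "a \<in> B \<longleftrightarrow> b \<in> B" if "B \<in> \<C>" for B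
      using that a b by (auto simp: \<C>_def \<Gamma>_def)
    have "s n a = s n b" for n
      by (rule sigma_measurable_inseparable[OF s[unfolded G_def] \<C>(1) same])
        (use a b in \<open>simp_all add: \<Gamma>_def\<close>)
    then have "(\<lambda>n. s n a) \<longlonglongrightarrow> b"
      using conv[OF b] by simp
    with conv[OF a] have "a = b"
      by (rule LIMSEQ_unique)
    with \<open>a \<noteq> b\<close> show False ..
  qed
  ultimately show ?thesis
    using \<Gamma> sets.sets_into_space[OF \<Gamma>] by (auto simp: spM M_def[symmetric])
qed

end
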